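(* Let $p\in(1/2,1]$ and let $Y$ be the ASEP with parameter $p$ (the case $p=1$ being the TASEP) with starting configuration $Y_n(0)=n$ for all $n\in\mathbb{Z}$. Let $X_n(t)$ denote the position of particle $n$ at time $t$, i.e. $Y_{X_n(t)}(t)=n$. Then for any fixed $t>0$ the process $\{X_n(t)\}_{n\in\mathbb{Z}}$ has the same distribution as $\{Y_n(t)\}_{n\in\mathbb{Z}}$.
   Context: Multi-type ASEP with parameter $p\in(1/2,1]$: a continuous-time Markov process $Y(t)=\{Y_n(t)\}_{n\in\mathbb{Z}}$ on $\mathbb{R}^{\mathbb{Z}}$, where $Y_n(t)$ is the class of the particle at site $n$ at time $t$. To each $n\in\mathbb{Z}$ attach an independent rate $1$ Poisson process; at each of its points, independently of everything else, with probability $p$ the values at sites $n,n+1$ are sorted into decreasing order (the larger value is placed at $n$, the smaller at $n+1$), and with probability $1-p$ they are sorted into increasing order; all other values are unchanged. (This is almost surely well defined.) The TASEP is the case $p=1$. When $Y_n(0)=n$, $Y(t)$ is at each time a permutation of $\mathbb{Z}$ and $X(t)$ is the inverse permutation. *)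

theory Defs
  imports "HOL-Probability.Probability"
begin

text \<open>
  The process is given by its graphical construction.  A realisation consists of one Poisson
  clock \<open>N n\<close> for each bond \<open>{n, n + 1}\<close> and one coin \<open>C n k\<close> for the \<open>k\<close>-th point of the
  clock \<open>N n\<close>, and \<open>Y\<close> is a process following the sorting rules driven by these clocks and
  coins.
\<close>

text \<open>
  Times are nonnegative reals; the values \<open>N t\<close> at \<open>t < 0\<close> are irrelevant.  The truncated
  subtraction in the increments is harmless since almost every path is nondecreasing.
\<close>

definition (in prob_space) poisson_process :: "real \<Rightarrow> (real \<Rightarrow> 'a \<Rightarrow> nat) \<Rightarrow> bool" where
  "poisson_process rate N \<longleftrightarrow>
     (\<forall>t\<ge>0. random_variable (count_space UNIV) (N t)) \<and>
     (AE \<omega> in M. N 0 \<omega> = 0 \<and>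
        (\<forall>s t. 0 \<le> s \<longrightarrow> s \<le> t \<longrightarrow> N s \<omega> \<le> N t \<omega>) \<and>
        (\<forall>t\<ge>0. eventually (\<lambda>s. N s \<omega> = N t \<omega>) (at_right t))) \<and>
     (\<forall>s t. 0 \<le> s \<longrightarrow> s < t \<longrightarrow>
        distr M (count_space UNIV) (\<lambda>\<omega>. N t \<omega> - N s \<omega>)
          = measure_pmf (poisson_pmf (rate * (t - s)))) \<and>
     (\<forall>(ts :: nat \<Rightarrow> real) k. 0 \<le> ts 0 \<longrightarrow> mono ts \<longrightarrow>
        indep_vars (\<lambda>_. count_space UNIV) (\<lambda>i \<omega>. N (ts (Suc i)) \<omega> - N (ts i) \<omega>) {..<k})"

definition rings_at :: "(real \<Rightarrow> nat) \<Rightarrow> real \<Rightarrow> bool" where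
  "rings_at c s \<longleftrightarrow> 0 < s \<and> (\<forall>r. 0 \<le> r \<longrightarrow> r < s \<longrightarrow> c r < c s)"

definition sort_bond :: "bool \<Rightarrow> int \<Rightarrow> (int \<Rightarrow> real) \<Rightarrow> (int \<Rightarrow> real)" where
  "sort_bond decreasing n \<eta> =
     (let a = max (\<eta> n) (\<eta> (n + 1)); b = min (\<eta> n) (\<eta> (n + 1))
      in if decreasing then \<eta>(n := a, n + 1 := b) else \<eta>(n := b, n + 1 := a))"

text \<open>
  \<open>c n\<close> is the path of the clock of the bond \<open>{n, n + 1}\<close>, \<open>d n k\<close> tells whether its \<open>k\<close>-th
  point (\<open>k = 1, 2, \<dots>\<close>) sorts into decreasing order, and \<open>y s n\<close> is the class at site \<open>n\<close> at
  time \<open>s\<close>.  When the clock of the bond \<open>{n, n + 1}\<close> rings at time \<open>s\<close>, the configuration just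
  before \<open>s\<close> gets sorted.  The left limit has to be taken separately at each site \<open>m\<close>: in
  every time interval infinitely many bonds ring.  The last conjunct says that a value can only
  change when one of the two bonds adjacent to its site rings.
\<close>

definition asep_dynamics ::
  "(int \<Rightarrow> real \<Rightarrow> nat) \<Rightarrow> (int \<Rightarrow> nat \<Rightarrow> bool) \<Rightarrow> (real \<Rightarrow> int \<Rightarrow> real) \<Rightarrow> bool" where
  "asep_dynamics c d y \<longleftrightarrow>
     (\<forall>n s. rings_at (c n) s \<longrightarrow>
        (\<forall>m. eventually (\<lambda>r. y s m = sort_bond (d n (c n s)) n (y r) m) (at_left s))) \<and>
     (\<forall>n s t. 0 \<le> s \<longrightarrow> s \<le> t \<longrightarrow>
        (\<forall>u. s < u \<longrightarrow> u \<le> t \<longrightarrow> \<not> rings_at (c (n - 1)) u \<and> \<not> rings_at (c n) u) \<longrightarrow>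
        y t n = y s n)"

text \<open>
  \<open>asep M p \<eta> N C Y\<close>: on the probability space \<open>M\<close>, the process \<open>Y\<close> is the multi-type ASEP with
  parameter \<open>p\<close> and (deterministic) starting configuration \<open>\<eta>\<close> driven by the rate 1 Poisson
  clocks \<open>N\<close> and the coins \<open>C\<close>, where \<open>C n k\<close> is true with probability \<open>p\<close>.  Clocks and coins
  are jointly independent: the clocks are independent of each other, as are the coins, and the
  family of all clocks is independent of the family of all coins.
\<close>

locale asep = prob_space M for M :: "'a measure" +
  fixes p :: real
    and \<eta> :: "int \<Rightarrow> real"
    and N :: "int \<Rightarrow> real \<Rightarrow> 'a \<Rightarrow> nat"
    and C :: "int \<Rightarrow> nat \<Rightarrow> 'a \<Rightarrow> bool"
    and Y :: "real \<Rightarrow> int \<Rightarrow> 'a \<Rightarrow> real"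
  assumes clocks: "\<And>n. poisson_process 1 (N n)"
    and coins: "\<And>n k. distr M (count_space UNIV) (C n k) = measure_pmf (bernoulli_pmf p)"
    and indep_clocks:
      "indep_vars (\<lambda>_. Pi\<^sub>M {0..} (\<lambda>_. count_space UNIV)) (\<lambda>n \<omega>. \<lambda>t\<in>{0..}. N n t \<omega>) UNIV"
    and indep_coins:
      "indep_vars (\<lambda>_. count_space UNIV) (\<lambda>(n, k). C n k) UNIV"
    and indep_clocks_coins:
      "indep_set
         (sets (vimage_algebra (space M) (\<lambda>\<omega> n. \<lambda>t\<in>{0..}. N n t \<omega>)
            (Pi\<^sub>M UNIV (\<lambda>_. Pi\<^sub>M {0..} (\<lambda>_. count_space UNIV)))))
         (sets (vimage_algebra (space M) (\<lambda>\<omega> (n, k). C n k \<omega>)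
            (Pi\<^sub>M UNIV (\<lambda>_. count_space UNIV))))"
    and measurable_Y: "\<And>t n. 0 \<le> t \<Longrightarrow> random_variable borel (Y t n)"
    and initial: "AE \<omega> in M. \<forall>n. Y 0 n \<omega> = \<eta> n"
    and dynamics:
      "AE \<omega> in M. asep_dynamics (\<lambda>n t. N n t \<omega>) (\<lambda>n k. C n k \<omega>) (\<lambda>t n. Y t n \<omega>)"

text \<open>
  The position of the particle of class \<open>v\<close> in the configuration \<open>\<eta>\<close>, i.e. the site \<open>m\<close> with
  \<open>\<eta> m = v\<close>.  For the process started from \<open>\<eta> n = n\<close> this site exists and is unique almost
  surely.  The default value 0 only matters on a null set; it is there because the value of
  \<open>THE\<close> in the absence of uniqueness may depend on the whole configuration in a
  non-measurable way.
\<close>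

definition position :: "(int \<Rightarrow> real) \<Rightarrow> real \<Rightarrow> int" where
  "position \<eta> v = (if \<exists>!m. \<eta> m = v then THE m. \<eta> m = v else 0)"

end

theory Submission
  imports Defs
begin

text \<open>
  Sorting the values at the sites \<open>n\<close>, \<open>n + 1\<close> and sorting the positions of the values \<open>m\<close>,
  \<open>m + 1\<close> are right and left multiplication in the Hecke algebra: they commute in law and agree
  on the identity.  Hence sorting a sequence of bonds, starting from the identity, yields in law
  the inverse of what the reversed sequence yields.  Poisson clocks on \<open>[0, t]\<close> are invariant under
  time reversal.  To see both facts on the infinite line, cut \<open>[0, t]\<close> into \<open>K\<close> equal slots and
  look at the bonds \<open>-L, \<dots>, L\<close>: with probability tending to 1 no slot contains two rings, so the
  rings form a word whose law is invariant under reversal, and some bond on either side of a given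
  finite set of sites is silent, so that this word determines the configuration in between.
\<close>

subsection \<open>Sorting sites and sorting values\<close>

abbreviation adj_swap :: "int \<Rightarrow> int \<Rightarrow> int" where
  "adj_swap n \<equiv> Transposition.transpose n (n + 1)"

text \<open>The equation between truth values says that the current order is the opposite of the one
  asked for by \<open>b\<close> (\<open>True\<close> for decreasing); only then are the two sites
  exchanged.\<close>

definition sort_sites :: "bool \<Rightarrow> int \<Rightarrow> (int \<Rightarrow> int) \<Rightarrow> int \<Rightarrow> int" where
  "sort_sites b n w = (if b = (w n < w (n + 1)) then w \<circ> adj_swap n else w)"

text \<open>Conjugation by inversion replaces precomposition with \<open>adj_swap\<close> by
  postcomposition; in this form inversion exchanges the two kinds of step by definition.\<close>

definition sort_values :: "bool \<Rightarrow> int \<Rightarrow> (int \<Rightarrow> int) \<Rightarrow> int \<Rightarrow> int" where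
  "sort_values b n w = inv (sort_sites b n (inv w))"

lemma bij_sort_sites: "bij w \<Longrightarrow> bij (sort_sites b n w)"
  by (auto simp: sort_sites_def bij_comp)

lemma sort_values_eq:
  assumes "bij w"
  shows "sort_values b n w
    = (if b = (inv w n < inv w (n + 1)) then adj_swap n \<circ> w else w)"
  using assms by (auto simp: sort_values_def sort_sites_def o_inv_distrib bij_imp_bij_inv inv_inv_eq)

lemma bij_sort_values: "bij w \<Longrightarrow> bij (sort_values b n w)"
  by (simp add: sort_values_def bij_imp_bij_inv bij_sort_sites)

text \<open>An adjacent transposition moves each point by at most one, so the only order it can
  reverse is that of the pair it exchanges.\<close>

lemma transpose_less_transpose_iff:
  fixes x y n :: int
  assumes "x \<noteq> y" "{x, y} \<noteq> {n, n + 1}"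
  shows "adj_swap n x < adj_swap n y \<longleftrightarrow> x < y"
  using assms by (auto simp: Transposition.transpose_def)

text \<open>The two swaps act on opposite sides of \<open>w\<close>, and outside the excluded case
  neither changes the comparison on which the other depends.\<close>

lemma sort_sites_sort_values_commute:
  assumes "bij w" "{w n, w (n + 1)} \<noteq> {m, m + 1}"
  shows "sort_values a m (sort_sites b n w) = sort_sites b n (sort_values a m w)"
proof -
  let ?s = "adj_swap n" and ?r = "adj_swap m"
  have inj: "w n \<noteq> w (n + 1)" "inv w m \<noteq> inv w (m + 1)"
    using bij_is_inj[OF assms(1)] bij_is_inj[OF bij_imp_bij_inv[OF assms(1)]]
    by (simp_all add: inj_eq)
  \<comment> \<open>The hypothesis carried over to positions; it protects the comparison of
    \<open>inv w m\<close> with \<open>inv w (m + 1)\<close> against the swap of sites.\<close>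
  have *: "{inv w m, inv w (m + 1)} \<noteq> {n, n + 1}"
  proof
    assume "{inv w m, inv w (m + 1)} = {n, n + 1}"
    then have "w ` {inv w m, inv w (m + 1)} = w ` {n, n + 1}" by simp
    with assms show False by (simp add: bij_is_surj surj_f_inv_f insert_commute)
  qed
  have 1: "(?r \<circ> w) n < (?r \<circ> w) (n + 1) \<longleftrightarrow> w n < w (n + 1)"
    using transpose_less_transpose_iff[OF inj(1) assms(2)] by simp
  have 2: "inv (w \<circ> ?s) m < inv (w \<circ> ?s) (m + 1) \<longleftrightarrow> inv w m < inv w (m + 1)"
    using transpose_less_transpose_iff[OF inj(2) *] assms(1) by (simp add: o_inv_distrib)
  show ?thesis
    unfolding sort_values_eq[OF assms(1)] sort_values_eq[OF bij_sort_sites[OF assms(1)]]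
    unfolding sort_sites_def
    by (cases "a = (inv w m < inv w (m + 1))"; cases "b = (w n < w (n + 1))")
      (simp_all only: 1 2 if_True if_False simp_thms o_assoc)
qed

text \<open>If the bond carries exactly the values \<open>m\<close> and \<open>m + 1\<close>,
  swapping its sites is swapping these values, and both tests ask whether \<open>m\<close> stands to
  the left of \<open>m + 1\<close>.\<close>

lemma sort_values_eq_sort_sites:
  assumes "bij w" "{w n, w (n + 1)} = {m, m + 1}"
  shows "sort_values b m w = sort_sites b n w"
proof -
  have inj: "w x = w y \<longleftrightarrow> x = y" for x y using assms(1) by (simp add: bij_def inj_eq)
  have *: "w \<circ> adj_swap n = Transposition.transpose (w n) (w (n + 1)) \<circ> w"
    by (rule ext) (auto simp: Transposition.transpose_def inj)
  have inv: "inv w (w x) = x" for x using assms(1) by (simp add: bij_is_inj)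
  consider "w n = m" "w (n + 1) = m + 1" | "w n = m + 1" "w (n + 1) = m"
    using assms(2) by (auto simp: doubleton_eq_iff)
  then show ?thesis
  proof cases
    case 1
    then have "inv w m = n" "inv w (m + 1) = n + 1" using inv[of n] inv[of "n + 1"] by auto
    with 1 show ?thesis by (simp add: sort_values_eq[OF assms(1)] sort_sites_def *)
  next
    case 2
    then have "inv w m = n + 1" "inv w (m + 1) = n" using inv[of n] inv[of "n + 1"] by auto
    with 2 show ?thesis
      by (simp add: sort_values_eq[OF assms(1)] sort_sites_def * transpose_commute)
  qed
qed

text \<open>A sort keeps the pair of values at its bond, and the resulting order is dictated by its
  own coin, so the last coin wins.\<close>

lemma sort_sites_sort_sites: "bij w \<Longrightarrow> sort_sites a n (sort_sites b n w) = sort_sites a n w"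
proof -
  assume "bij w"
  then have "w n \<noteq> w (n + 1)" by (auto simp: bij_def inj_eq)
  then show ?thesis by (auto simp: sort_sites_def fun_eq_iff)
qed

section \<open>Random sorting steps and the law of a word\<close>

definition step_sites :: "real \<Rightarrow> int \<Rightarrow> (int \<Rightarrow> int) \<Rightarrow> (int \<Rightarrow> int) pmf" where
  "step_sites p n w = map_pmf (\<lambda>b. sort_sites b n w) (bernoulli_pmf p)"

definition step_values :: "real \<Rightarrow> int \<Rightarrow> (int \<Rightarrow> int) \<Rightarrow> (int \<Rightarrow> int) pmf" where
  "step_values p n w = map_pmf (\<lambda>b. sort_values b n w) (bernoulli_pmf p)"

text \<open>If the values at \<open>n\<close>, \<open>n + 1\<close> are \<open>m\<close>, \<open>m + 1\<close>, then either order of the two operations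
  leaves the outcome of the last coin, so they commute only in law.\<close>

lemma step_sites_step_values_commute:
  assumes "bij w"
  shows "step_sites p n w \<bind> step_values p m = step_values p m w \<bind> step_sites p n"
proof (cases "{w n, w (n + 1)} = {m, m + 1}")
  case False
  then show ?thesis
    using sort_sites_sort_values_commute[OF assms False]
    unfolding step_sites_def[abs_def] step_values_def[abs_def]
    by (simp add: map_pmf_def bind_assoc_pmf bind_return_pmf)
      (subst bind_commute_pmf, simp)
next
  case True
  have "{sort_sites b n w n, sort_sites b n w (n + 1)} = {m, m + 1}" for b
    using True by (auto simp: sort_sites_def)
  then have "sort_values a m (sort_sites b n w) = sort_sites a n w" for a b
    using sort_values_eq_sort_sites[OF bij_sort_sites[OF assms]] sort_sites_sort_sites[OF assms]
    by metis
  moreover have "sort_sites a n (sort_values b m w) = sort_sites a n w" for a b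
    by (simp add: sort_values_eq_sort_sites[OF assms True] sort_sites_sort_sites assms)
  ultimately show ?thesis
    by (simp add: step_sites_def[abs_def] step_values_def[abs_def] map_pmf_def bind_assoc_pmf
        bind_return_pmf)
qed

text \<open>The identity is its own inverse, and on it swapping sites and swapping values
  coincide.\<close>

lemma step_values_id: "step_values p n id = step_sites p n id"
  by (simp add: step_values_def step_sites_def sort_values_eq sort_sites_def cong: if_cong)

lemma map_inv_step_sites: "map_pmf inv (step_sites p n w) = step_values p n (inv w)" if "bij w"
  using that by (simp add: step_values_def step_sites_def sort_values_def map_pmf_comp inv_inv_eq)

text \<open>The head of the list acts last, and every letter \<open>Some n\<close> tosses a fresh
  coin.\<close>

fun law_sites :: "real \<Rightarrow> int option list \<Rightarrow> (int \<Rightarrow> int) pmf" where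
  "law_sites p [] = return_pmf id"
| "law_sites p (None # fs) = law_sites p fs"
| "law_sites p (Some n # fs) = law_sites p fs \<bind> step_sites p n"

fun law_values :: "real \<Rightarrow> int option list \<Rightarrow> (int \<Rightarrow> int) pmf" where
  "law_values p [] = return_pmf id"
| "law_values p (None # fs) = law_values p fs"
| "law_values p (Some n # fs) = law_values p fs \<bind> step_values p n"

lemma bij_law_sites: "w \<in> set_pmf (law_sites p fs) \<Longrightarrow> bij w"
  by (induction p fs arbitrary: w rule: law_sites.induct)
    (auto simp: step_sites_def bij_sort_sites)

lemma map_inv_law_sites: "map_pmf inv (law_sites p fs) = law_values p fs"
proof (induction p fs rule: law_sites.induct)
  case (3 p n fs)
  have "map_pmf inv (law_sites p (Some n # fs))
      = law_sites p fs \<bind> (\<lambda>w. step_values p n (inv w))"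
    by (auto simp: map_bind_pmf map_inv_step_sites dest: bij_law_sites intro!: bind_pmf_cong)
  also have "\<dots> = map_pmf inv (law_sites p fs) \<bind> step_values p n"
    by (simp add: bind_map_pmf)
  finally show ?case using 3 by simp
qed auto

lemma bij_law_values: "w \<in> set_pmf (law_values p fs) \<Longrightarrow> bij w"
  by (induction p fs arbitrary: w rule: law_values.induct)
    (auto simp: step_values_def bij_sort_values)

lemma law_values_append_None: "law_values p (fs @ [None]) = law_values p fs"
  by (induction p fs rule: law_values.induct) auto

text \<open>The appended letter acts first, on the identity, where a step on values is also a step
  on sites; commutation then carries it outward past all the other steps on values.\<close>

lemma law_values_append_Some:
  "law_values p (fs @ [Some n]) = law_values p fs \<bind> step_sites p n"
proof (induction p fs rule: law_values.induct)
  case (1 p)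
  then show ?case by (simp add: bind_return_pmf step_values_id)
next
  case (3 p m fs)
  have "law_values p (Some m # fs @ [Some n])
      = law_values p fs \<bind> (\<lambda>w. step_sites p n w \<bind> step_values p m)"
    using 3 by (simp add: bind_assoc_pmf)
  also have "\<dots> = law_values p fs \<bind> (\<lambda>w. step_values p m w \<bind> step_sites p n)"
    by (intro bind_pmf_cong refl step_sites_step_values_commute) (rule bij_law_values)
  finally show ?case by (simp add: bind_assoc_pmf)
qed simp

lemma law_values_rev: "law_values p (rev fs) = law_sites p fs"
  by (induction p fs rule: law_sites.induct)
    (auto simp: law_values_append_None law_values_append_Some)

text \<open>Inversion turns steps on sites into steps on values, and these build the law on sites
  from the other end of the word.\<close>

lemma map_inv_law_sites_rev: "map_pmf inv (law_sites p fs) = law_sites p (rev fs)"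
  using law_values_rev[of p "rev fs"] by (simp add: map_inv_law_sites)

subsection \<open>Pathwise analysis\<close>

text \<open>The head of the list is the most recent slot, \<open>None\<close> a slot without a ring.\<close>

fun config :: "(int \<Rightarrow> nat \<Rightarrow> bool) \<Rightarrow> int option list \<Rightarrow> int \<Rightarrow> int" where
  "config d [] = id"
| "config d (None # fs) = config d fs"
| "config d (Some n # fs) = sort_sites (d n (Suc (count_list fs (Some n)))) n (config d fs)"

lemma bij_config: "bij (config d fs)"
proof (induction d fs rule: config.induct)
  case (1 d)
  show ?case unfolding config.simps by (rule bij_id)
qed (simp_all add: bij_sort_sites)

text \<open>The bonds \<open>a\<close> and \<open>b\<close> are the ones across the two ends of the
  block \<open>{a<..b}\<close>; if neither occurs in the word, every swap preserves the
  block.\<close>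

lemma config_in_block_iff:
  assumes "Some a \<notin> set fs" "Some b \<notin> set fs"
  shows "config d fs m \<in> {a<..b} \<longleftrightarrow> m \<in> {a<..b}"
  using assms
proof (induction d fs arbitrary: m rule: config.induct)
  case (3 d n fs)
  have "n \<noteq> a" "n \<noteq> b" using "3.prems" by auto
  then have *: "adj_swap n m \<in> {a<..b} \<longleftrightarrow> m \<in> {a<..b}"
    by (simp add: Transposition.transpose_def) linarith
  have IH: "config d fs m \<in> {a<..b} \<longleftrightarrow> m \<in> {a<..b}" for m
    using "3.prems" by (intro "3.IH") simp_all
  show ?case
    by (simp only: config.simps sort_sites_def comp_apply IH * simp_thms split: if_split)
qed simp_all

lemma inv_config_in_block:
  assumes "Some a \<notin> set fs" "Some b \<notin> set fs" "m \<in> {a<..b}"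
  shows "inv (config d fs) m \<in> {a<..b}"
  using config_in_block_iff[OF assms(1,2), of d "inv (config d fs) m"] assms(3)
  by (simp add: bij_config bij_is_surj surj_f_inv_f)

section \<open>Jumps of a single clock path\<close>

definition clock_path :: "(real \<Rightarrow> nat) \<Rightarrow> bool" where
  "clock_path c \<longleftrightarrow> c 0 = 0 \<and> (\<forall>s t. 0 \<le> s \<longrightarrow> s \<le> t \<longrightarrow> c s \<le> c t) \<and>
     (\<forall>t\<ge>0. eventually (\<lambda>s. c s = c t) (at_right t))"

lemma clock_path_mono: "clock_path c \<Longrightarrow> 0 \<le> s \<Longrightarrow> s \<le> t \<Longrightarrow> c s \<le> c t"
  by (simp add: clock_path_def)

lemma not_rings_at_constant:
  assumes "clock_path c" "0 \<le> r" "r < u" "c r = c u"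
  shows "\<not> rings_at c u"
  using assms by (auto simp: rings_at_def)

lemma not_rings_at_slot:
  assumes "clock_path c" "0 \<le> s0" "c s1 = c s0" "s0 < u" "u \<le> s1"
  shows "\<not> rings_at c u"
  using assms clock_path_mono[OF assms(1), of s0 u] clock_path_mono[OF assms(1), of u s1]
  by (intro not_rings_at_constant[OF assms(1), of s0]) auto

text \<open>A nondecreasing integer path that grows by one takes only two values on the slot, so it
  jumps once, at the infimum of the times at the upper value.\<close>

lemma single_ring:
  assumes c: "clock_path c" and s: "0 \<le> s0" "s0 \<le> s1" and inc: "c s1 = Suc (c s0)"
  obtains u where "s0 < u" "u \<le> s1" "rings_at c u" "c u = c s1"
    "\<And>v. s0 < v \<Longrightarrow> v < u \<Longrightarrow> c v = c s0"
    "\<And>v. u < v \<Longrightarrow> v \<le> s1 \<Longrightarrow> c v = c s1"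
proof -
  note mono = clock_path_mono[OF c]
  have ne: "s0 < s1" using s inc by (cases "s0 = s1") auto
  define S where "S = {r \<in> {s0..s1}. c r = c s1}"
  define u where "u = Inf S"
  have S: "s1 \<in> S" using s by (simp add: S_def)
  have bdd: "bdd_below S" by (rule bdd_belowI[of _ s0]) (simp add: S_def)
  have "s0 \<le> u" unfolding u_def using S by (intro cInf_greatest) (auto simp: S_def)
  moreover have "u \<le> s1" unfolding u_def using S bdd by (rule cInf_lower)
  ultimately have u01: "s0 \<le> u" "u \<le> s1" .
  have two: "c r = c s0 \<or> c r = c s1" if "s0 \<le> r" "r \<le> s1" for r
    using mono[of s0 r] mono[of r s1] that s inc by auto
  have above: "c v = c s1" if v: "u < v" "v \<le> s1" for v
  proof -
    obtain r where "r \<in> S" "r < v" using cInf_lessD[of S v] v(1) S unfolding u_def by blast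
    then have "0 \<le> r" "r \<le> v" "c r = c s1" using s by (simp_all add: S_def)
    then show ?thesis using mono[of r v] mono[of v s1] v by linarith
  qed
  have below: "c v = c s0" if "s0 \<le> v" "v < u" for v
  proof (rule ccontr)
    assume "c v \<noteq> c s0"
    then have "v \<in> S" using two[of v] that u01 by (auto simp: S_def)
    then show False using cInf_lower[OF _ bdd, of v] that by (simp add: u_def)
  qed
  \<comment> \<open>By right continuity the infimum itself already has the upper value.\<close>
  have cu: "c u = c s1"
  proof (cases "u = s1")
    case False
    have "eventually (\<lambda>r. c r = c u) (at_right u)"
      using c s u01 by (auto simp: clock_path_def)
    then obtain e where e: "e > u" "\<And>r. u < r \<Longrightarrow> r < e \<Longrightarrow> c r = c u"
      unfolding eventually_at_right_field by blast
    obtain r where "u < r" "r < min e s1" using e(1) u01 False dense[of u "min e s1"] by auto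
    with e(2)[of r] above[of r] show ?thesis by simp
  qed simp
  then have su: "s0 < u" using u01 inc by (cases "u = s0") auto
  \<comment> \<open>\<open>rings_at\<close> compares with all earlier times, including those before
    the slot; hence the use of \<open>max r s0\<close>.\<close>
  have "c r < c u" if "0 \<le> r" "r < u" for r
  proof -
    have "c r \<le> c (max r s0)" using that by (intro mono) auto
    also have "\<dots> = c s0" using below[of "max r s0"] that su by simp
    finally show ?thesis using cu inc by simp
  qed
  then have "rings_at c u" using su s by (simp add: rings_at_def)
  then show thesis using that[OF su u01(2) _ cu below above] by simp
qed

section \<open>Evolution during one slot and along a word\<close>

lemma quiet_slot:
  assumes dyn: "asep_dynamics c d y" and c: "\<And>n. clock_path (c n)"
    and s: "0 \<le> s0" "s0 \<le> s1" and q: "c (m - 1) s1 = c (m - 1) s0" "c m s1 = c m s0"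
  shows "y s1 m = y s0 m"
  using dyn s not_rings_at_slot[OF c s(1) q(1)] not_rings_at_slot[OF c s(1) q(2)]
  unfolding asep_dynamics_def by metis

lemma sort_bond_cong:
  "\<eta> n = \<theta> n \<Longrightarrow> \<eta> (n + 1) = \<theta> (n + 1) \<Longrightarrow> \<eta> m = \<theta> m \<Longrightarrow> sort_bond b n \<eta> m = sort_bond b n \<theta> m"
  by (simp add: sort_bond_def Let_def)

lemma sort_bond_of_int:
  assumes "w n \<noteq> w (n + 1)"
  shows "sort_bond b n (\<lambda>m. real_of_int (w m)) m = real_of_int (sort_sites b n w m)"
  using assms by (auto simp: sort_bond_def sort_sites_def Let_def Transposition.transpose_def)

text \<open>Among the bonds touching the block only \<open>k\<close> rings, so the block is frozen
  before and after that ring. As \<open>a < k < b\<close>, both sites of the bond lie in the block,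
  and the left limit there is the configuration at \<open>s0\<close>.\<close>

lemma ring_slot:
  assumes dyn: "asep_dynamics c d y" and c: "\<And>n. clock_path (c n)"
    and s: "0 \<le> s0" "s0 \<le> s1" and k: "a < k" "k < b" and inc: "c k s1 = Suc (c k s0)"
    and q: "\<And>n. a \<le> n \<Longrightarrow> n \<le> b \<Longrightarrow> n \<noteq> k \<Longrightarrow> c n s1 = c n s0"
    and m: "m \<in> {a<..b}"
  shows "y s1 m = sort_bond (d k (c k s1)) k (y s0) m"
proof -
  obtain u where u: "s0 < u" "u \<le> s1" "rings_at (c k) u" "c k u = c k s1"
    "\<And>v. s0 < v \<Longrightarrow> v < u \<Longrightarrow> c k v = c k s0"
    "\<And>v. u < v \<Longrightarrow> v \<le> s1 \<Longrightarrow> c k v = c k s1"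
    using single_ring[OF c s inc] by metis
  have cn: "c n v = c n s0" if "a \<le> n" "n \<le> b" "n \<noteq> k" "s0 \<le> v" "v \<le> s1" for n v
    using clock_path_mono[OF c, of s0 v n] clock_path_mono[OF c, of v s1 n] q[of n] that s by auto
  have before: "y r j = y s0 j" if "s0 < r" "r < u" "j \<in> {a<..b}" for r j
  proof (rule quiet_slot[OF dyn c])
    have *: "c n r = c n s0" if "a \<le> n" "n \<le> b" for n
    proof (cases "n = k")
      case True
      then show ?thesis using u(5) \<open>s0 < r\<close> \<open>r < u\<close> by simp
    next
      case False
      then show ?thesis using \<open>s0 < r\<close> \<open>r < u\<close> u(2) that by (intro cn) auto
    qed
    show "c (j - 1) r = c (j - 1) s0" "c j r = c j s0"
      using that(3) by (auto intro!: *)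
  qed (use s(1) that in linarith)+
  have after: "y s1 j = y u j" if "j \<in> {a<..b}" for j
  proof (rule quiet_slot[OF dyn c])
    have *: "c n s1 = c n u" if "a \<le> n" "n \<le> b" for n
    proof (cases "n = k")
      case True
      then show ?thesis using u(4) by simp
    next
      case False
      then have "c n u = c n s0" using u(1,2) that by (intro cn) auto
      then show ?thesis using q[OF that False] by simp
    qed
    show "c (j - 1) s1 = c (j - 1) u" "c j s1 = c j u"
      using that by (auto intro!: *)
  qed (use s(1) u(1,2) in linarith)+
  have "eventually (\<lambda>r. y u m = sort_bond (d k (c k u)) k (y r) m) (at_left u)"
    using dyn u(3) by (auto simp: asep_dynamics_def)
  then obtain e where e: "e < u" "\<And>r. e < r \<Longrightarrow> r < u \<Longrightarrow> y u m = sort_bond (d k (c k u)) k (y r) m"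
    unfolding eventually_at_left_field by blast
  \<comment> \<open>\<open>r\<close> is close enough to \<open>u\<close> for the left limit at
    \<open>m\<close>, and inside the slot, where the block is still frozen.\<close>
  obtain r where r: "max e s0 < r" "r < u" using dense[of "max e s0" u] e(1) u(1) by auto
  have "y u m = sort_bond (d k (c k u)) k (y r) m" using e(2) r by simp
  also have "\<dots> = sort_bond (d k (c k u)) k (y s0) m"
    using before[of r] r k m by (intro sort_bond_cong) auto
  finally show ?thesis using after[OF m] u(4) by simp
qed

text \<open>Slots are listed from oldest to newest, the opposite of the order in
  \<open>config\<close>; hence \<open>rev gs\<close> below. A letter prescribes the increments of
  all bonds from \<open>-L\<close> to \<open>L\<close>; bonds further out are unconstrained.\<close>

definition follows :: "(int \<Rightarrow> real \<Rightarrow> nat) \<Rightarrow> real \<Rightarrow> int \<Rightarrow> int option list \<Rightarrow> bool" where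
  "follows c t L gs \<longleftrightarrow> (\<forall>i<length gs. \<forall>n\<in>{-L..L}.
     c n (t * real (Suc i) / real (length gs)) - c n (t * real i / real (length gs))
       = of_bool (gs ! i = Some n))"

text \<open>The silent bonds \<open>a\<close> and \<open>b\<close> shield the block from the rest of
  the line, so induction over the slots works: a letter strictly between them sorts, any other
  letter leaves the block unchanged.\<close>

lemma dynamics_eq_config:
  assumes dyn: "asep_dynamics c d y" and c: "\<And>n. clock_path (c n)"
    and y0: "\<And>n. y 0 n = real_of_int n" and t: "0 < t"
    and gs: "follows c t L gs" "gs \<noteq> []"
    and ab: "-L \<le> a" "b \<le> L" "Some a \<notin> set gs" "Some b \<notin> set gs" and m: "m \<in> {a<..b}"
  shows "y t m = real_of_int (config d (rev gs) m)"
proof -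
  let ?K = "length gs"
  define \<tau> where "\<tau> i = t * real i / real ?K" for i
  have \<tau>0: "\<tau> 0 = 0" and \<tau>K: "\<tau> ?K = t" using gs(2) by (auto simp: \<tau>_def)
  have \<tau>: "0 \<le> \<tau> i" "\<tau> i \<le> \<tau> (Suc i)" for i
    using t by (auto simp: \<tau>_def divide_right_mono)
  have inc: "c n (\<tau> (Suc i)) = c n (\<tau> i) + of_bool (gs ! i = Some n)"
    if "i < ?K" "n \<in> {-L..L}" for i n
    using gs(1) that clock_path_mono[OF c \<tau>, of n i] unfolding follows_def \<tau>_def
    by (metis le_add_diff_inverse)
  \<comment> \<open>The clock counts the letters read so far, so the next ring of bond
    \<open>n\<close> uses the coin whose index is one more than this count, exactly as in
    \<open>config\<close>.\<close>
  have count: "c n (\<tau> i) = count_list (take i gs) (Some n)" if "i \<le> ?K" "n \<in> {-L..L}" for i n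
    using that
  proof (induction i)
    case 0
    then show ?case using c by (simp add: \<tau>0 clock_path_def)
  next
    case (Suc i)
    then show ?case using inc[of i n] by (auto simp: take_Suc_conv_app_nth)
  qed
  have "\<forall>m\<in>{a<..b}. y (\<tau> i) m = real_of_int (config d (rev (take i gs)) m)" if "i \<le> ?K" for i
    using that
  proof (induction i)
    case 0
    then show ?case by (simp add: y0 \<tau>0)
  next
    case (Suc i)
    let ?w = "config d (rev (take i gs))"
    have i: "i < ?K" using Suc by simp
    have w: "y (\<tau> i) m = real_of_int (?w m)" if "m \<in> {a<..b}" for m
      using Suc that by simp
    have tk: "rev (take (Suc i) gs) = gs ! i # rev (take i gs)"
      using i by (simp add: take_Suc_conv_app_nth)
    have mem: "gs ! i \<in> set gs" using i by simp
    show ?case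
    proof (cases "\<exists>k\<in>{a<..<b}. gs ! i = Some k")
      case True
      then obtain k where k: "a < k" "k < b" "gs ! i = Some k" by auto
      have kL: "k \<in> {-L..L}" using k ab by auto
      have ck: "c k (\<tau> (Suc i)) = Suc (count_list (rev (take i gs)) (Some k))"
        using inc[OF i kL] count[of i k] i kL k by simp
      show ?thesis
      proof
        fix m assume m: "m \<in> {a<..b}"
        have "y (\<tau> (Suc i)) m = sort_bond (d k (c k (\<tau> (Suc i)))) k (y (\<tau> i)) m"
          using inc[OF i] k ab kL by (intro ring_slot[OF dyn c \<tau> k(1,2) _ _ m]) auto
        also have "\<dots> = sort_bond (d k (c k (\<tau> (Suc i)))) k (\<lambda>m. real_of_int (?w m)) m"
          using w m k by (intro sort_bond_cong) auto
        also have "\<dots> = real_of_int (sort_sites (d k (c k (\<tau> (Suc i)))) k ?w m)"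
          using bij_config[of d "rev (take i gs)"] by (intro sort_bond_of_int) (simp add: bij_def inj_eq)
        finally show "y (\<tau> (Suc i)) m = real_of_int (config d (rev (take (Suc i) gs)) m)"
          by (simp add: tk k ck)
      qed
    next
      case False
      have quiet: "c n (\<tau> (Suc i)) = c n (\<tau> i)" if "a \<le> n" "n \<le> b" for n
      proof -
        have "gs ! i \<noteq> Some n" using False that ab mem
          by (cases "n = a"; cases "n = b") auto
        then show ?thesis using inc[OF i, of n] that ab by auto
      qed
      show ?thesis
      proof
        fix m assume m: "m \<in> {a<..b}"
        have "y (\<tau> (Suc i)) m = y (\<tau> i) m"
          using m by (intro quiet_slot[OF dyn c \<tau>] quiet) auto
        moreover have "config d (rev (take (Suc i) gs)) m = ?w m"
        proof (cases "gs ! i")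
          case (Some k)
          \<comment> \<open>Since \<open>a\<close> and \<open>b\<close> are not letters of the word,
            the bond lies outside \<open>{a..b}\<close> and its swap fixes every site of the
            block.\<close>
          then have "k < a \<or> b < k" using False ab mem by (cases "k = a"; cases "k = b") auto
          then have "adj_swap k m = m" using m by (auto simp: Transposition.transpose_def)
          then show ?thesis by (simp add: tk Some sort_sites_def)
        qed (simp add: tk)
        ultimately show "y (\<tau> (Suc i)) m = real_of_int (config d (rev (take (Suc i) gs)) m)"
          using w m by simp
      qed
    qed
  qed
  from this[of ?K] m show ?thesis by (simp add: \<tau>K)
qed

subsection \<open>Laws of coins and clocks\<close>

lemma measure_bind_bernoulli:
  "measure (bind_pmf (bernoulli_pmf p) f) A = (\<Sum>b\<in>UNIV. pmf (bernoulli_pmf p) b * measure (f b) A)"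
proof -
  have "ennreal (measure (bind_pmf (bernoulli_pmf p) f) A)
      = (\<integral>\<^sup>+b. ennreal (measure (f b) A) \<partial>bernoulli_pmf p)"
    by (simp flip: measure_pmf.emeasure_eq_measure)
  also have "\<dots> = ennreal (\<integral>b. measure (f b) A \<partial>bernoulli_pmf p)"
    by (intro nn_integral_eq_integral measure_pmf.integrable_const_bound[of _ 1]) auto
  finally have "measure (bind_pmf (bernoulli_pmf p) f) A = (\<integral>b. measure (f b) A \<partial>bernoulli_pmf p)"
    by (simp add: integral_nonneg)
  also have "\<dots> = (\<Sum>b\<in>UNIV. pmf (bernoulli_pmf p) b * measure (f b) A)"
    by (subst integral_measure_pmf[of UNIV]) auto
  finally show ?thesis .
qed

text \<open>Condition on the coin of the head letter, which acts last as a fixed map once its coin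
  is known.\<close>

lemma measure_law_sites_Some:
  "measure (law_sites p (Some n # fs)) A
    = (\<Sum>b\<in>UNIV. pmf (bernoulli_pmf p) b * measure (law_sites p fs) (sort_sites b n -` A))"
proof -
  have "law_sites p (Some n # fs)
      = law_sites p fs \<bind> (\<lambda>w. bernoulli_pmf p \<bind> (\<lambda>b. return_pmf (sort_sites b n w)))"
    by (simp add: step_sites_def[abs_def] map_pmf_def)
  also have "\<dots> = bernoulli_pmf p \<bind> (\<lambda>b. map_pmf (sort_sites b n) (law_sites p fs))"
    by (subst bind_commute_pmf) (simp add: map_pmf_def)
  finally show ?thesis by (simp add: measure_bind_bernoulli del: law_sites.simps)
qed

section \<open>Law of the configuration as a function of the coins\<close>

abbreviation (in asep) "coin_algebra \<equiv> vimage_algebra (space M) (\<lambda>\<omega> (n, k). C n k \<omega>)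
  (Pi\<^sub>M UNIV (\<lambda>_. count_space UNIV))"

abbreviation (in asep) "clock_algebra \<equiv> vimage_algebra (space M) (\<lambda>\<omega> n. \<lambda>t\<in>{0..}. N n t \<omega>)
  (Pi\<^sub>M UNIV (\<lambda>_. Pi\<^sub>M {0..} (\<lambda>_. count_space UNIV)))"

lemma (in asep) measurable_coin: "C n k \<in> coin_algebra \<rightarrow>\<^sub>M count_space UNIV"
proof -
  have "(\<lambda>\<omega> (n, k). C n k \<omega>) \<in> coin_algebra \<rightarrow>\<^sub>M Pi\<^sub>M UNIV (\<lambda>_. count_space UNIV)"
    by (rule measurable_vimage_algebra1) (simp add: space_PiM)
  from measurable_compose[OF this measurable_component_singleton[of "(n, k)"]]
  show ?thesis by simp
qed

text \<open>Only finitely many coins enter, so the map is measurable even for the full power set of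
  its uncountable target.\<close>

lemma (in asep) measurable_config:
  "(\<lambda>\<omega>. config (\<lambda>n k. C n k \<omega>) fs) \<in> coin_algebra \<rightarrow>\<^sub>M count_space UNIV"
proof (induction "\<lambda>_ :: int. \<lambda>_ :: nat. True" fs rule: config.induct)
  case (3 n fs)
  have "(\<lambda>\<omega>. (\<lambda>b \<omega>. sort_sites b n (config (\<lambda>n k. C n k \<omega>) fs))
      (C n (Suc (count_list fs (Some n))) \<omega>) \<omega>) \<in> coin_algebra \<rightarrow>\<^sub>M count_space UNIV"
    by (rule measurable_compose_countable[OF _ measurable_coin])
      (rule measurable_compose[OF 3], simp)
  then show ?case by simp
qed simp_all

lemma (in asep) coin_algebra_sets: "sets coin_algebra \<subseteq> events"
  by (rule indep_setD_ev2[OF indep_clocks_coins])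

lemma (in asep) clock_algebra_sets: "sets clock_algebra \<subseteq> events"
  by (rule indep_setD_ev1[OF indep_clocks_coins])

lemma (in asep) config_event_coin:
  "{\<omega> \<in> space M. config (\<lambda>n k. C n k \<omega>) fs \<in> A} \<in> sets coin_algebra"
proof -
  have "{\<omega> \<in> space M. config (\<lambda>n k. C n k \<omega>) fs \<in> A}
      = (\<lambda>\<omega>. config (\<lambda>n k. C n k \<omega>) fs) -` A \<inter> space coin_algebra"
    unfolding space_vimage_algebra by blast
  then show ?thesis by (simp only: measurable_sets[OF measurable_config] UNIV_I sets_count_space Pow_UNIV)
qed

lemma (in asep) random_variable_coin: "random_variable (count_space UNIV) (C n k)"
  by (rule measurable_from_subalg[OF _ measurable_coin])
    (simp add: subalgebra_def coin_algebra_sets)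

lemma (in asep) coin_event: "{\<omega> \<in> space M. C n k \<omega> = b} \<in> events"
proof -
  have "{\<omega> \<in> space M. C n k \<omega> = b} = C n k -` {b} \<inter> space M" by blast
  then show ?thesis by (simp only: measurable_sets[OF random_variable_coin] UNIV_I sets_count_space Pow_UNIV)
qed

lemma (in asep) coins_event:
  assumes "finite J"
  shows "{\<omega> \<in> space M. \<forall>i\<in>J. case_prod C i \<omega> = \<beta> i} \<in> events"
  using assms by (intro sets.sets_Collect_finite_All) (simp_all add: coin_event case_prod_unfold)

lemma (in asep) prob_coin: "prob (C n k -` {b} \<inter> space M) = pmf (bernoulli_pmf p) b"
proof -
  have "measure (distr M (count_space UNIV) (C n k)) {b} = prob (C n k -` {b} \<inter> space M)"
    by (rule measure_distr[OF random_variable_coin]) simp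
  then show ?thesis
    by (simp only: coins measure_pmf_single)
qed

lemma (in asep) prob_coins:
  assumes "finite J"
  shows "prob {\<omega> \<in> space M. \<forall>i\<in>J. case_prod C i \<omega> = \<beta> i} = (\<Prod>i\<in>J. pmf (bernoulli_pmf p) (\<beta> i))"
proof (cases "J = {}")
  case True
  then show ?thesis by (simp add: prob_space)
next
  case False
  have "{\<omega> \<in> space M. \<forall>i\<in>J. case_prod C i \<omega> = \<beta> i}
      = (\<Inter>i\<in>J. case_prod C i -` {\<beta> i} \<inter> space M)"
    using False by blast
  also have "prob \<dots> = (\<Prod>i\<in>J. prob (case_prod C i -` {\<beta> i} \<inter> space M))"
    using False assms by (intro indep_varsD[OF indep_coins]) simp_all
  also have "\<dots> = (\<Prod>i\<in>J. pmf (bernoulli_pmf p) (\<beta> i))"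
    by (intro prod.cong refl) (simp only: prob_coin split_def)
  finally show ?thesis .
qed

text \<open>Strengthened for the induction: the coins in \<open>J\<close> have indices beyond those
  read by \<open>fs\<close>. Removing the head letter releases its coin, which then joins
  \<open>J\<close>.\<close>

lemma (in asep) prob_config_coins:
  assumes "finite J" "\<forall>(n, k)\<in>J. count_list fs (Some n) < k"
  shows "prob {\<omega> \<in> space M. config (\<lambda>n k. C n k \<omega>) fs \<in> A \<and> (\<forall>i\<in>J. case_prod C i \<omega> = \<beta> i)}
    = measure (law_sites p fs) A * (\<Prod>i\<in>J. pmf (bernoulli_pmf p) (\<beta> i))"
  using assms
proof (induction fs arbitrary: J A \<beta>)
  case Nil
  then show ?case
    unfolding config.simps law_sites.simps
    by (cases "id \<in> A") (simp_all only: prob_coins measure_return_pmf, simp_all add: prob_coins)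
next
  case (Cons x fs)
  show ?case
  proof (cases x)
    case None
    then show ?thesis using Cons.IH[OF Cons.prems(1), of A \<beta>] Cons.prems(2)
      by (simp only: config.simps law_sites.simps) simp
  next
    case (Some n)
    \<comment> \<open>The index of the coin read by the head letter: beyond those read by
      \<open>fs\<close>, and below those of bond \<open>n\<close> in \<open>J\<close>.\<close>
    define k where "k = Suc (count_list fs (Some n))"
    have J: "\<forall>(m, l)\<in>insert (n, k) J. count_list fs (Some m) < l" and nk: "(n, k) \<notin> J"
      using Cons.prems(2) by (auto simp: Some k_def split: if_splits)
    let ?B = "\<lambda>b. {\<omega> \<in> space M. config (\<lambda>n k. C n k \<omega>) fs \<in> sort_sites b n -` A \<and>
      (\<forall>i\<in>insert (n, k) J. case_prod C i \<omega> = (\<beta>((n, k) := b)) i)}"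
    have B: "?B b \<in> events" for b
    proof -
      have "?B b = {\<omega> \<in> space M. config (\<lambda>n k. C n k \<omega>) fs \<in> sort_sites b n -` A} \<inter>
        {\<omega> \<in> space M. \<forall>i\<in>insert (n, k) J. case_prod C i \<omega> = (\<beta>((n, k) := b)) i}" by auto
      also have "\<dots> \<in> events"
        using Cons.prems(1)
        by (intro sets.Int coins_event subsetD[OF coin_algebra_sets config_event_coin]) simp
      finally show ?thesis .
    qed
    have pB: "prob (?B b) = measure (law_sites p fs) (sort_sites b n -` A) *
        (pmf (bernoulli_pmf p) b * (\<Prod>i\<in>J. pmf (bernoulli_pmf p) (\<beta> i)))" for b
    proof -
      have "(\<Prod>i\<in>J. pmf (bernoulli_pmf p) ((\<beta>((n, k) := b)) i)) = (\<Prod>i\<in>J. pmf (bernoulli_pmf p) (\<beta> i))"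
        using nk by (intro prod.cong) auto
      then show ?thesis
        unfolding Cons.IH[OF iffD2[OF finite_insert Cons.prems(1)] J]
          prod.insert[OF Cons.prems(1) nk] fun_upd_same by (simp only:)
    qed
    have restrict: "(\<forall>i\<in>insert (n, k) J. case_prod C i \<omega> = (\<beta>((n, k) := b)) i) \<longleftrightarrow>
        C n k \<omega> = b \<and> (\<forall>i\<in>J. case_prod C i \<omega> = \<beta> i)" for b \<omega>
    proof -
      have "(\<beta>((n, k) := b)) i = \<beta> i" if "i \<in> J" for i using that nk by auto
      then show ?thesis by (simp del: fun_upd_apply add: fun_upd_same)
    qed
    \<comment> \<open>Split according to the value of the coin of the head letter.\<close>
    have "{\<omega> \<in> space M. config (\<lambda>n k. C n k \<omega>) (x # fs) \<in> A \<and> (\<forall>i\<in>J. case_prod C i \<omega> = \<beta> i)}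
        = (\<Union>b\<in>UNIV. ?B b)"
      unfolding restrict Some config.simps k_def[symmetric] by blast
    also have "prob \<dots> = (\<Sum>b\<in>UNIV. prob (?B b))"
      by (intro finite_measure_finite_Union image_subsetI B finite) (auto simp: disjoint_family_on_def)
    also have "\<dots> = measure (law_sites p (x # fs)) A * (\<Prod>i\<in>J. pmf (bernoulli_pmf p) (\<beta> i))"
      unfolding pB Some measure_law_sites_Some sum_distrib_right by (simp only: mult_ac)
    finally show ?thesis .
  qed
qed

lemma (in asep) prob_config:
  "prob {\<omega> \<in> space M. config (\<lambda>n k. C n k \<omega>) fs \<in> A} = measure (law_sites p fs) A"
  using prob_config_coins[of "{}" fs A undefined]
  by (simp only: Ball_def empty_iff prod.empty mult_1_right simp_thms finite.emptyI)

section \<open>Increments of the clocks\<close>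

lemma (in asep) measurable_clock:
  "(\<lambda>\<omega>. \<lambda>t\<in>{0..}. N n t \<omega>) \<in> clock_algebra \<rightarrow>\<^sub>M Pi\<^sub>M {0..} (\<lambda>_. count_space UNIV)"
proof -
  have "(\<lambda>\<omega> n. \<lambda>t\<in>{0..}. N n t \<omega>) \<in> clock_algebra \<rightarrow>\<^sub>M
      Pi\<^sub>M UNIV (\<lambda>_. Pi\<^sub>M {0..} (\<lambda>_. count_space UNIV))"
    by (rule measurable_vimage_algebra1) (simp add: space_PiM PiE_iff)
  from measurable_compose[OF this measurable_component_singleton[of n]]
  show ?thesis by simp
qed

text \<open>A cylinder in path space: the clocks are independent as whole paths, so events about
  their increments are pulled back from there.\<close>

definition increments_at :: "nat \<Rightarrow> (nat \<Rightarrow> real) \<Rightarrow> (nat \<Rightarrow> nat set) \<Rightarrow> (real \<Rightarrow> nat) set" where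
  "increments_at K \<tau> D = {h \<in> space (Pi\<^sub>M {0..} (\<lambda>_. count_space UNIV)).
     \<forall>i\<in>{..<K}. h (\<tau> (Suc i)) - h (\<tau> i) \<in> D i}"

lemma sets_increments_at:
  assumes "\<And>i. 0 \<le> \<tau> i"
  shows "increments_at K \<tau> D \<in> sets (Pi\<^sub>M {0..} (\<lambda>_. count_space UNIV))"
  unfolding increments_at_def
proof (rule sets.sets_Collect_finite_All)
  fix i
  have [measurable]: "(\<lambda>h. h (\<tau> j)) \<in> Pi\<^sub>M {0..} (\<lambda>_. count_space UNIV) \<rightarrow>\<^sub>M count_space (UNIV :: nat set)" for j
    using assms by (intro measurable_component_singleton) simp
  show "{h \<in> space (Pi\<^sub>M {0..} (\<lambda>_. count_space UNIV)). h (\<tau> (Suc i)) - h (\<tau> i) \<in> D i}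
      \<in> sets (Pi\<^sub>M {0..} (\<lambda>_. count_space UNIV))"
    by measurable
qed simp

lemma (in asep) clock_in_increments_at:
  assumes "\<And>i. 0 \<le> \<tau> i"
  shows "(\<lambda>t\<in>{0..}. N n t \<omega>) \<in> increments_at K \<tau> D \<longleftrightarrow>
    (\<forall>i<K. N n (\<tau> (Suc i)) \<omega> - N n (\<tau> i) \<omega> \<in> D i)"
  using assms by (simp add: increments_at_def space_PiM Ball_def)

text \<open>Membership in \<open>clock_algebra\<close>, and not just in \<open>events\<close>, is
  what later gives independence from the coins.\<close>

lemma (in asep) increments_event_clock:
  assumes "\<And>i. 0 \<le> \<tau> i" "finite J"
  shows "{\<omega> \<in> space M. \<forall>n\<in>J. \<forall>i<K. N n (\<tau> (Suc i)) \<omega> - N n (\<tau> i) \<omega> \<in> D n i} \<in> sets clock_algebra"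
proof -
  have *: "{\<omega> \<in> space clock_algebra. \<forall>i<K. N n (\<tau> (Suc i)) \<omega> - N n (\<tau> i) \<omega> \<in> D n i} \<in> sets clock_algebra" for n
  proof -
    have "{\<omega> \<in> space clock_algebra. \<forall>i<K. N n (\<tau> (Suc i)) \<omega> - N n (\<tau> i) \<omega> \<in> D n i} =
      (\<lambda>\<omega>. \<lambda>t\<in>{0..}. N n t \<omega>) -` increments_at K \<tau> (D n) \<inter> space clock_algebra"
      unfolding vimage_def clock_in_increments_at[OF assms(1)] space_vimage_algebra by blast
    then show ?thesis
      by (simp only: measurable_sets[OF measurable_clock sets_increments_at[OF assms(1)]])
  qed
  have "{\<omega> \<in> space clock_algebra. \<forall>n\<in>J. \<forall>i<K. N n (\<tau> (Suc i)) \<omega> - N n (\<tau> i) \<omega> \<in> D n i} \<in> sets clock_algebra"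
    by (rule sets.sets_Collect_finite_All[OF * assms(2)])
  then show ?thesis by (simp only: space_vimage_algebra)
qed

lemma (in asep) prob_clock_increments:
  assumes \<tau>: "\<tau> 0 = 0" "\<And>i. \<tau> i < \<tau> (Suc i)" and K: "0 < K"
  shows "prob {\<omega> \<in> space M. \<forall>i<K. N n (\<tau> (Suc i)) \<omega> - N n (\<tau> i) \<omega> \<in> D i}
    = (\<Prod>i<K. measure (poisson_pmf (\<tau> (Suc i) - \<tau> i)) (D i))"
proof -
  have mono: "mono \<tau>" by (intro incseq_SucI less_imp_le \<tau>(2))
  have \<tau>0: "0 \<le> \<tau> i" for i using monoD[OF mono, of 0 i] \<tau>(1) by simp
  let ?I = "\<lambda>i \<omega>. N n (\<tau> (Suc i)) \<omega> - N n (\<tau> i) \<omega>"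
  have indep: "indep_vars (\<lambda>_. count_space UNIV) ?I {..<K}"
    using clocks[of n] mono \<tau>(1) unfolding poisson_process_def by simp
  have rv: "random_variable (count_space UNIV) (?I i)" if "i < K" for i
    using indep that unfolding indep_vars_def by auto
  have "prob (?I i -` D i \<inter> space M) = measure (poisson_pmf (\<tau> (Suc i) - \<tau> i)) (D i)" if "i < K" for i
  proof -
    have "distr M (count_space UNIV) (?I i) = measure_pmf (poisson_pmf (1 * (\<tau> (Suc i) - \<tau> i)))"
      using clocks[of n] \<tau>0[of i] \<tau>(2)[of i] unfolding poisson_process_def by blast
    then show ?thesis using measure_distr[OF rv[OF that], of "D i"] by simp
  qed
  moreover have "{\<omega> \<in> space M. \<forall>i<K. ?I i \<omega> \<in> D i} = (\<Inter>i\<in>{..<K}. ?I i -` D i \<inter> space M)"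
    using K by auto
  moreover have "prob (\<Inter>i\<in>{..<K}. ?I i -` D i \<inter> space M) = (\<Prod>i<K. prob (?I i -` D i \<inter> space M))"
    using K by (intro indep_varsD[OF indep]) auto
  ultimately show ?thesis by simp
qed

lemma (in asep) prob_clocks_increments:
  assumes \<tau>: "\<tau> 0 = 0" "\<And>i. \<tau> i < \<tau> (Suc i)" and K: "0 < K" and J: "finite J"
  shows "prob {\<omega> \<in> space M. \<forall>n\<in>J. \<forall>i<K. N n (\<tau> (Suc i)) \<omega> - N n (\<tau> i) \<omega> \<in> D n i}
    = (\<Prod>n\<in>J. \<Prod>i<K. measure (poisson_pmf (\<tau> (Suc i) - \<tau> i)) (D n i))"
proof (cases "J = {}")
  case True
  then show ?thesis by (simp add: prob_space)
next
  case False
  have mono: "mono \<tau>" by (intro incseq_SucI less_imp_le \<tau>(2))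
  have \<tau>0: "0 \<le> \<tau> i" for i using monoD[OF mono, of 0 i] \<tau>(1) by simp
  let ?X = "\<lambda>n \<omega>. \<lambda>t\<in>{0..}. N n t \<omega>"
  have vimage: "?X n -` increments_at K \<tau> (D n) \<inter> space M
      = {\<omega> \<in> space M. \<forall>i<K. N n (\<tau> (Suc i)) \<omega> - N n (\<tau> i) \<omega> \<in> D n i}" for n
    unfolding vimage_def clock_in_increments_at[OF \<tau>0] by blast
  have "{\<omega> \<in> space M. \<forall>n\<in>J. \<forall>i<K. N n (\<tau> (Suc i)) \<omega> - N n (\<tau> i) \<omega> \<in> D n i}
      = (\<Inter>n\<in>J. ?X n -` increments_at K \<tau> (D n) \<inter> space M)"
    unfolding vimage using False by blast
  also have "prob \<dots> = (\<Prod>n\<in>J. prob (?X n -` increments_at K \<tau> (D n) \<inter> space M))"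
    using J False \<tau>0 by (intro indep_varsD[OF indep_clocks] sets_increments_at) auto
  also have "\<dots> = (\<Prod>n\<in>J. \<Prod>i<K. measure (poisson_pmf (\<tau> (Suc i) - \<tau> i)) (D n i))"
    unfolding vimage using prob_clock_increments[OF \<tau> K] by simp
  finally show ?thesis .
qed

subsection \<open>Words of rings\<close>

definition alphabet :: "int \<Rightarrow> int option set" where
  "alphabet L = insert None (Some ` {-L..L})"

definition words :: "nat \<Rightarrow> int \<Rightarrow> int option list set" where
  "words K L = {gs. set gs \<subseteq> alphabet L \<and> length gs = K}"

text \<open>The two missing letters are silent bonds whose block \<open>{a<..b}\<close> contains
  \<open>{-m..m}\<close>. The condition does not see the order of the letters.\<close>

definition good_words :: "nat \<Rightarrow> int \<Rightarrow> int \<Rightarrow> int option list set" where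
  "good_words K L m = {gs \<in> words K L.
     (\<exists>a\<in>{-L..<-m}. Some a \<notin> set gs) \<and> (\<exists>b\<in>{m<..L}. Some b \<notin> set gs)}"

lemma finite_alphabet: "finite (alphabet L)"
  by (simp add: alphabet_def)

lemma finite_words: "finite (words K L)"
  unfolding words_def by (rule finite_lists_length_eq[OF finite_alphabet])

lemma finite_good_words: "finite (good_words K L m)"
  by (rule finite_subset[OF _ finite_words]) (auto simp: good_words_def)

lemma rev_in_good_words: "rev gs \<in> good_words K L m \<longleftrightarrow> gs \<in> good_words K L m"
  by (simp add: good_words_def words_def)

text \<open>By independence of the clocks, the probability that in a slot of length \<open>l\<close>
  the observed bonds ring as the letter \<open>x\<close> prescribes.\<close>

definition slot_weight :: "real \<Rightarrow> int \<Rightarrow> int option \<Rightarrow> real" where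
  "slot_weight l L x = (\<Prod>n\<in>{-L..L}. pmf (poisson_pmf l) (of_bool (x = Some n)))"

lemma sum_prod_list_words:
  fixes f :: "'b \<Rightarrow> real"
  assumes "finite A"
  shows "(\<Sum>xs | set xs \<subseteq> A \<and> length xs = K. prod_list (map f xs)) = (\<Sum>x\<in>A. f x) ^ K"
proof (induction K)
  case 0
  have "{xs. set xs \<subseteq> A \<and> length xs = 0} = {[]}" by auto
  then show ?case by simp
next
  case (Suc K)
  let ?W = "\<lambda>K. {xs. set xs \<subseteq> A \<and> length xs = K}"
  have "?W (Suc K) = (\<lambda>(xs, x). x # xs) ` (?W K \<times> A)"
    using lists_length_Suc_eq[of A K] by (simp add: image_iff)
  then have "(\<Sum>xs\<in>?W (Suc K). prod_list (map f xs)) = (\<Sum>(xs, x)\<in>?W K \<times> A. f x * prod_list (map f xs))"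
    by (simp add: sum.reindex inj_on_def case_prod_unfold)
  also have "\<dots> = (\<Sum>xs\<in>?W K. \<Sum>x\<in>A. f x * prod_list (map f xs))"
    by (simp add: sum.cartesian_product)
  also have "\<dots> = (\<Sum>x\<in>A. f x) * (\<Sum>xs\<in>?W K. prod_list (map f xs))"
    by (simp add: sum_distrib_left sum_distrib_right)
  finally show ?case using Suc by simp
qed

text \<open>Summing over all words gives \<open>exp (- M * t) * (1 + M * t / K) ^ K\<close>, where \<open>M\<close> is the number of
  bonds: this tends to 1, so two rings in one slot can be neglected.\<close>

lemma sum_slot_weight:
  assumes "0 < l"
  shows "(\<Sum>x\<in>alphabet L. slot_weight l L x)
    = exp (- real (card {-L..L}) * l) * (1 + real (card {-L..L}) * l)"
proof -
  let ?M = "card {-L..L}"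
  have none: "slot_weight l L None = exp (- real ?M * l)"
  proof -
    have "slot_weight l L None = exp (- l) ^ ?M"
      unfolding slot_weight_def using assms by (simp del: card_atLeastAtMost_int)
    then show ?thesis by (simp only: exp_of_nat_mult[symmetric] minus_mult_commute)
  qed
  have some: "slot_weight l L (Some k) = l * exp (- real ?M * l)" if "k \<in> {-L..L}" for k
  proof -
    have "slot_weight l L (Some k) = (\<Prod>n\<in>{-L..L}. (if n = k then l else 1) * exp (- l))"
      unfolding slot_weight_def using assms by (intro prod.cong) auto
    also have "\<dots> = (\<Prod>n\<in>{-L..L}. if n = k then l else 1) * exp (- l) ^ ?M"
      by (simp only: prod.distrib prod_constant)
    also have "(\<Prod>n\<in>{-L..L}. if n = k then l else 1) = l"
      using that by (subst prod.delta) auto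
    finally show ?thesis by (simp only: exp_of_nat_mult[symmetric] minus_mult_commute)
  qed
  have "(\<Sum>x\<in>alphabet L. slot_weight l L x)
      = slot_weight l L None + (\<Sum>k\<in>{-L..L}. slot_weight l L (Some k))"
    unfolding alphabet_def by (subst sum.insert) (auto simp: sum.reindex)
  also have "\<dots> = exp (- real ?M * l) + real ?M * (l * exp (- real ?M * l))"
    by (simp only: none some sum_constant cong: sum.cong)
  finally show ?thesis by (simp only: algebra_simps)
qed

lemma total_slot_weight_tendsto:
  assumes "0 < t"
  shows "(\<lambda>K. (\<Sum>gs\<in>words K L. prod_list (map (slot_weight (t / real K) L) gs))) \<longlonglongrightarrow> 1"
proof -
  let ?M = "real (card {-L..L})"
  have "(\<lambda>K. exp (- ?M * t) * (1 + ?M * t / real K) ^ K) \<longlonglongrightarrow> exp (- ?M * t) * exp (?M * t)"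
    by (intro tendsto_mult tendsto_const tendsto_exp_limit_sequentially)
  then have lim: "(\<lambda>K. exp (- ?M * t) * (1 + ?M * t / real K) ^ K) \<longlonglongrightarrow> 1"
    by (simp flip: exp_add)
  have eq: "(\<Sum>gs\<in>words K L. prod_list (map (slot_weight (t / real K) L) gs))
      = exp (- ?M * t) * (1 + ?M * t / real K) ^ K" if "0 < K" for K
  proof -
    have "(\<Sum>gs\<in>words K L. prod_list (map (slot_weight (t / real K) L) gs))
        = (exp (- ?M * (t / real K)) * (1 + ?M * (t / real K))) ^ K"
      unfolding words_def using assms that
      by (subst sum_prod_list_words[OF finite_alphabet], subst sum_slot_weight) simp_all
    also have "\<dots> = exp (real K * (- ?M * (t / real K))) * (1 + ?M * t / real K) ^ K"
      by (simp only: power_mult_distrib exp_of_nat_mult[symmetric] times_divide_eq_right)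
    finally show ?thesis using that by simp
  qed
  show ?thesis
    by (rule Lim_transform_eventually[OF lim])
      (use eq in \<open>auto intro: eventually_sequentiallyI[of 1]\<close>)
qed

section \<open>Probability that the clocks follow a word\<close>

lemma (in asep) follows_iff:
  "follows (\<lambda>n s. N n s \<omega>) t L gs \<longleftrightarrow> (\<forall>n\<in>{-L..L}. \<forall>i<length gs.
     N n (t * real (Suc i) / real (length gs)) \<omega> - N n (t * real i / real (length gs)) \<omega>
       \<in> {of_bool (gs ! i = Some n)})"
  unfolding follows_def by blast

abbreviation (in asep) follows_event :: "real \<Rightarrow> int \<Rightarrow> int option list \<Rightarrow> 'a set" where
  "follows_event t L gs \<equiv> {\<omega> \<in> space M. follows (\<lambda>n s. N n s \<omega>) t L gs}"

lemma (in asep) follows_event_clock: "0 < t \<Longrightarrow> follows_event t L gs \<in> sets clock_algebra"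
  unfolding follows_iff
  by (rule increments_event_clock[of "\<lambda>i. t * real i / real (length gs)"]) simp_all

text \<open>Independence over bonds and over slots gives a double product; grouped by slots it
  leaves one factor per letter, the same function of the letter in each slot because all slots have
  equal length.\<close>

lemma (in asep) prob_follows:
  assumes "0 < t" "gs \<noteq> []"
  shows "prob (follows_event t L gs) = prod_list (map (slot_weight (t / real (length gs)) L) gs)"
proof -
  let ?K = "length gs"
  let ?w = "\<lambda>n i. measure (poisson_pmf (t / real ?K)) {of_bool (gs ! i = Some n)}"
  have K: "0 < ?K" using assms by simp
  have diff: "t * real (Suc i) / real ?K - t * real i / real ?K = t / real ?K" for i
    by (simp add: algebra_simps flip: diff_divide_distrib)
  have less: "t * real i / real ?K < t * real (Suc i) / real ?K" for i
    using diff[of i] K assms(1) by (smt (verit) divide_pos_pos of_nat_0_less_iff)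
  have "prob (follows_event t L gs) = (\<Prod>n\<in>{-L..L}. \<Prod>i<?K. ?w n i)"
    unfolding follows_iff
    by (subst prob_clocks_increments[of "\<lambda>i. t * real i / real (length gs)"])
      (simp_all only: less K diff, simp_all)
  also have "\<dots> = (\<Prod>i<?K. \<Prod>n\<in>{-L..L}. ?w n i)"
    by (rule prod.swap)
  also have "\<dots> = (\<Prod>i<?K. slot_weight (t / real ?K) L (gs ! i))"
    by (simp only: slot_weight_def measure_pmf_single)
  also have "\<dots> = prod_list (map (slot_weight (t / real ?K) L) gs)"
    by (simp add: prod.list_conv_set_nth atLeast0LessThan)
  finally show ?thesis .
qed

text \<open>Time reversal of the clocks: the weight of a word is a product over its letters in any
  order.\<close>

lemma (in asep) prob_follows_rev:
  "0 < t \<Longrightarrow> gs \<noteq> [] \<Longrightarrow> prob (follows_event t L (rev gs)) = prob (follows_event t L gs)"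
  by (simp add: prob_follows flip: rev_map)

text \<open>The restriction to \<open>words K L\<close> matters: letters beyond the observed bonds
  leave no trace in the observed increments.\<close>

lemma follows_unique:
  assumes "follows c t L gs" "follows c t L fs" "gs \<in> words K L" "fs \<in> words K L"
  shows "gs = fs"
proof (rule nth_equalityI)
  show len: "length gs = length fs" using assms by (simp add: words_def)
  fix i assume i: "i < length gs"
  have eq: "gs ! i = Some n \<longleftrightarrow> fs ! i = Some n" if "n \<in> {-L..L}" for n
  proof -
    have "of_bool (gs ! i = Some n) = (of_bool (fs ! i = Some n) :: nat)"
      using assms(1,2) that i len unfolding follows_def by metis
    then show ?thesis by (simp only: of_bool_eq_iff)
  qed
  have "gs ! i \<in> alphabet L" "fs ! i \<in> alphabet L"
    using assms(3,4) i len by (auto simp: words_def)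
  then show "gs ! i = fs ! i" unfolding alphabet_def using eq by (metis image_iff insert_iff)
qed

lemma (in asep) follows_event_events: "0 < t \<Longrightarrow> follows_event t L gs \<in> events"
  using follows_event_clock clock_algebra_sets by blast

lemma (in asep) disjoint_follows: "disjoint_family_on (follows_event t L) (words K L)"
  unfolding disjoint_family_on_def using follows_unique by blast

section \<open>Silent bonds and good words\<close>

lemma (in asep) prob_silent:
  assumes "0 < t" "finite J"
  shows "prob {\<omega> \<in> space M. \<forall>n\<in>J. N n t \<omega> - N n 0 \<omega> \<noteq> 0} = (1 - exp (- t)) ^ card J"
    and "{\<omega> \<in> space M. \<forall>n\<in>J. N n t \<omega> - N n 0 \<omega> \<noteq> 0} \<in> events"
proof -
  \<comment> \<open>The whole of \<open>[0, t]\<close> is treated as a single slot, in which each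
    clock rings with probability \<open>1 - exp (- t)\<close>.\<close>
  let ?\<tau> = "\<lambda>i. t * real i"
  have eq: "{\<omega> \<in> space M. \<forall>n\<in>J. N n t \<omega> - N n 0 \<omega> \<noteq> 0} =
    {\<omega> \<in> space M. \<forall>n\<in>J. \<forall>i<1. N n (?\<tau> (Suc i)) \<omega> - N n (?\<tau> i) \<omega> \<in> - {0}}"
    by simp
  have *: "measure (poisson_pmf t) (- {0}) = 1 - exp (- t)"
    using assms measure_pmf.prob_compl[of "{0}" "poisson_pmf t"] by (simp add: measure_pmf_single Compl_eq_Diff_UNIV)
  show "prob {\<omega> \<in> space M. \<forall>n\<in>J. N n t \<omega> - N n 0 \<omega> \<noteq> 0} = (1 - exp (- t)) ^ card J"
    unfolding eq using assms by (subst prob_clocks_increments) (simp_all add: distrib_left *)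
  show "{\<omega> \<in> space M. \<forall>n\<in>J. N n t \<omega> - N n 0 \<omega> \<noteq> 0} \<in> events"
    unfolding eq using assms clock_algebra_sets
    by (intro subsetD[OF clock_algebra_sets] increments_event_clock) simp_all
qed

lemma follows_silent:
  assumes c: "clock_path (c a)" and "0 < t" "follows c t L gs" "a \<in> {-L..L}" "c a t - c a 0 = 0"
  shows "Some a \<notin> set gs"
proof
  assume "Some a \<in> set gs"
  then obtain i where i: "i < length gs" "gs ! i = Some a" by (metis in_set_conv_nth)
  let ?\<tau> = "\<lambda>i. t * real i / real (length gs)"
  have "c a (?\<tau> (Suc i)) - c a (?\<tau> i) = 1"
    using assms(3,4) i unfolding follows_def by simp
  moreover have "c a (?\<tau> (Suc i)) \<le> c a t"
  proof (rule clock_path_mono[OF c])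
    have "t * real (Suc i) \<le> t * real (length gs)" using i assms(2) by (intro mult_left_mono) auto
    then show "?\<tau> (Suc i) \<le> t" using i by (simp only: pos_divide_le_eq of_nat_0_less_iff)
  qed (use assms(2) in simp)
  moreover have "c a 0 \<le> c a (?\<tau> i)"
    using assms(2) by (intro clock_path_mono[OF c]) auto
  ultimately show False using assms(5) by simp
qed

lemma (in asep) AE_clock_path: "AE \<omega> in M. \<forall>n. clock_path (\<lambda>s. N n s \<omega>)"
  using clocks unfolding AE_all_countable poisson_process_def clock_path_def by blast

text \<open>Three errors, each below a third of \<epsilon>: several observed rings in one slot, no
  silent bond on the left, none on the right. First \<open>L\<close> is chosen for the silent bonds,
  then \<open>K\<close> for this \<open>L\<close>.\<close>

lemma (in asep) exists_good_words_prob: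
  assumes t: "0 < t" and \<epsilon>: "0 < \<epsilon>" and m: "0 \<le> m"
  obtains K L where "0 < K" "1 - \<epsilon> < prob (\<Union>gs\<in>good_words K L m. follows_event t L gs)"
proof -
  define q where "q = 1 - exp (- t)"
  have q: "0 < q" "q < 1" using t by (auto simp: q_def)
  \<comment> \<open>\<open>q ^ j\<close> is the probability that \<open>j\<close> given bonds all
    ring; \<open>L\<close> is then set so that exactly \<open>j\<close> bonds are available on each
    side.\<close>
  obtain j where j: "q ^ j < \<epsilon> / 3" using real_arch_pow_inv[of "\<epsilon> / 3" q] q \<epsilon> by auto
  define L where "L = m + int j"
  have "\<forall>\<^sub>F K in sequentially. 1 - \<epsilon> / 3 < (\<Sum>gs\<in>words K L. prod_list (map (slot_weight (t / real K) L) gs))"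
    using \<epsilon> by (intro order_tendstoD(1)[OF total_slot_weight_tendsto[OF t]]) simp
  then have "\<forall>\<^sub>F K in sequentially. 0 < K \<and> 1 - \<epsilon> / 3 < (\<Sum>gs\<in>words K L. prod_list (map (slot_weight (t / real K) L) gs))"
    by (intro eventually_conj eventually_gt_at_top)
  then obtain K where K: "0 < K"
    "1 - \<epsilon> / 3 < (\<Sum>gs\<in>words K L. prod_list (map (slot_weight (t / real K) L) gs))"
    by (metis (no_types, lifting) eventually_happens' sequentially_bot)
  let ?all = "\<Union>gs\<in>words K L. follows_event t L gs"
  let ?good = "\<Union>gs\<in>good_words K L m. follows_event t L gs"
  let ?R = "\<lambda>J. {\<omega> \<in> space M. \<forall>n\<in>J. N n t \<omega> - N n 0 \<omega> \<noteq> 0}"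
  let ?l = "{-L..<-m}" and ?r = "{m<..L}"
  have "prob ?all = (\<Sum>gs\<in>words K L. prob (follows_event t L gs))"
    by (intro finite_measure_finite_Union finite_words disjoint_follows image_subsetI follows_event_events t)
  also have "\<dots> = (\<Sum>gs\<in>words K L. prod_list (map (slot_weight (t / real K) L) gs))"
    using K t by (intro sum.cong refl) (auto simp: words_def prob_follows)
  finally have all: "1 - \<epsilon> / 3 < prob ?all" using K by simp
  have R: "prob (?R ?l) < \<epsilon> / 3" "prob (?R ?r) < \<epsilon> / 3"
    using j unfolding prob_silent(1)[OF t finite_atLeastLessThan_int]
      prob_silent(1)[OF t finite_greaterThanAtMost_int] q_def[symmetric] by (simp_all add: L_def)
  \<comment> \<open>A silent bond cannot be a letter, so if the followed word is not good, all bonds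
    on one side have rung.\<close>
  have "AE \<omega> in M. \<omega> \<in> ?all \<longrightarrow> \<omega> \<in> ?good \<union> (?R ?l \<union> ?R ?r)"
    using AE_clock_path
  proof eventually_elim
    case (elim \<omega>)
    show ?case
    proof (intro impI)
      assume "\<omega> \<in> ?all"
      then obtain gs where gs: "gs \<in> words K L" "\<omega> \<in> space M" "follows (\<lambda>n s. N n s \<omega>) t L gs" by blast
      have silent: "Some n \<notin> set gs" if "n \<in> {-L..L}" "N n t \<omega> - N n 0 \<omega> = 0" for n
        using follows_silent[of "\<lambda>n s. N n s \<omega>", OF _ t gs(3) that] elim by blast
      show "\<omega> \<in> ?good \<union> (?R ?l \<union> ?R ?r)"
      proof (rule ccontr)
        assume no: "\<omega> \<notin> ?good \<union> (?R ?l \<union> ?R ?r)"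
        then obtain a b where ab: "a \<in> ?l" "N a t \<omega> - N a 0 \<omega> = 0" "b \<in> ?r" "N b t \<omega> - N b 0 \<omega> = 0"
          using gs(2) by blast
        have "a \<in> {-L..L}" "b \<in> {-L..L}" using ab m by auto
        then have "gs \<in> good_words K L m"
          using gs(1) ab silent unfolding good_words_def by blast
        then show False using no gs by blast
      qed
    qed
  qed
  then have "prob ?all \<le> prob (?good \<union> (?R ?l \<union> ?R ?r))"
    using t by (intro finite_measure_mono_AE sets.Un sets.finite_UN finite_good_words follows_event_events prob_silent(2)) simp_all
  also have "\<dots> \<le> prob ?good + prob (?R ?l \<union> ?R ?r)"
    using t by (intro measure_Un_le sets.Un sets.finite_UN finite_good_words follows_event_events prob_silent(2)) simp_all
  also have "prob (?R ?l \<union> ?R ?r) \<le> prob (?R ?l) + prob (?R ?r)"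
    using t by (intro measure_Un_le prob_silent(2)) simp_all
  finally have "1 - \<epsilon> < prob ?good" using all R by simp
  with K(1) show thesis by (rule that)
qed

text \<open>Here \<open>K\<close> and \<open>L\<close> may depend on the realisation, so the
  probability bounds \<open>1 - \<epsilon>\<close> add up to an almost sure statement. Having all
  \<open>m\<close> at once gives access to the whole line.\<close>

lemma (in asep) AE_exists_good_words:
  assumes t: "0 < t"
  shows "AE \<omega> in M. \<forall>m::nat. \<exists>K L. \<exists>gs\<in>good_words K L (int m). 0 < K \<and> follows (\<lambda>n s. N n s \<omega>) t L gs"
proof (unfold AE_all_countable, intro allI)
  fix m :: nat
  let ?G = "\<lambda>K L. \<Union>gs\<in>good_words K L (int m). follows_event t L gs"
  let ?U = "\<Union>K\<in>{0<..}. \<Union>L. ?G K L"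
  have G: "?G K L \<in> events" for K L
    by (intro sets.finite_UN finite_good_words follows_event_events t)
  have U: "?U \<in> events"
    by (intro sets.countable_UN'' G) simp_all
  have "1 \<le> prob ?U + \<epsilon>" if \<epsilon>: "0 < \<epsilon>" for \<epsilon>
  proof -
    obtain K L where K: "0 < K" "1 - \<epsilon> < prob (?G K L)"
      using exists_good_words_prob[OF t \<epsilon>, of "int m"] by auto
    have "prob (?G K L) \<le> prob ?U"
      using K(1) by (intro finite_measure_mono U) blast
    with K(2) show ?thesis by simp
  qed
  then have "1 \<le> prob ?U" by (rule field_le_epsilon)
  then have "prob ?U = 1" using prob_le_1[of ?U] by simp
  then have "AE \<omega> in M. \<omega> \<in> ?U" by (rule AE_prob_1)
  then show "AE \<omega> in M. \<exists>K L. \<exists>gs\<in>good_words K L (int m). 0 < K \<and> follows (\<lambda>n s. N n s \<omega>) t L gs"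
    by eventually_elim blast
qed

text \<open>One good word finds the value \<open>j\<close> inside its block; excluding a second site
  anywhere on the line takes a good word for a larger interval.\<close>

lemma position_eq_inv_config:
  assumes dyn: "asep_dynamics c d y" and c: "\<And>n. clock_path (c n)"
    and y0: "\<And>n. y 0 n = real_of_int n" and t: "0 < t"
    and ex: "\<And>m::nat. \<exists>K L. \<exists>gs\<in>good_words K L (int m). 0 < K \<and> follows c t L gs"
    and gs: "gs \<in> good_words K L m" "0 < K" "follows c t L gs"
    and j: "j \<in> {-m..m}"
  shows "y t j = real_of_int (config d (rev gs) j)"
    and "position (y t) (real_of_int j) = inv (config d (rev gs)) j"
proof -
  have block: "\<exists>a b. Some a \<notin> set gs \<and> Some b \<notin> set gs \<and> {-m..m} \<subseteq> {a<..b} \<and>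
      (\<forall>i\<in>{a<..b}. y t i = real_of_int (config d (rev gs) i))"
    if gs: "gs \<in> good_words K L m" "0 < K" "follows c t L gs" for gs K L m
  proof -
    obtain a b where ab: "a \<in> {-L..<-m}" "Some a \<notin> set gs" "b \<in> {m<..L}" "Some b \<notin> set gs"
      using gs(1) unfolding good_words_def by blast
    have "gs \<noteq> []" using gs unfolding good_words_def words_def by auto
    then have "\<forall>i\<in>{a<..b}. y t i = real_of_int (config d (rev gs) i)"
      using ab dynamics_eq_config[OF dyn c y0 t gs(3)] by auto
    moreover have "{-m..m} \<subseteq> {a<..b}" using ab by auto
    ultimately show ?thesis using ab by blast
  qed
  from block[OF gs] obtain a b where ab: "Some a \<notin> set gs" "Some b \<notin> set gs" "{-m..m} \<subseteq> {a<..b}"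
    "\<forall>i\<in>{a<..b}. y t i = real_of_int (config d (rev gs) i)" by blast
  then show "y t j = real_of_int (config d (rev gs) j)" using j by blast
  define i where "i = inv (config d (rev gs)) j"
  have "i \<in> {a<..b}" unfolding i_def using ab j by (intro inv_config_in_block) auto
  then have yi: "y t i = real_of_int j"
    using ab(4) by (simp add: i_def bij_config bij_is_surj surj_f_inv_f)
  have uniq: "i' = i" if "y t i' = real_of_int j" for i'
  proof -
    \<comment> \<open>Large enough for the new block to contain both \<open>i\<close> and its
      competitor \<open>i'\<close>; there \<open>Y\<close> agrees with an injective
      configuration.\<close>
    define m' where "m' = nat (max \<bar>i\<bar> \<bar>i'\<bar>)"
    obtain K' L' gs' where "gs' \<in> good_words K' L' (int m')" "0 < K'" "follows c t L' gs'"
      using ex[of m'] by blast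
    from block[OF this] obtain a' b' where *: "{-int m'..int m'} \<subseteq> {a'<..b'}"
      "\<forall>i\<in>{a'<..b'}. y t i = real_of_int (config d (rev gs') i)" by blast
    have "i \<in> {-int m'..int m'}" "i' \<in> {-int m'..int m'}" unfolding m'_def by simp_all linarith+
    then have "y t i = real_of_int (config d (rev gs') i)" "y t i' = real_of_int (config d (rev gs') i')"
      using * by blast+
    then have "config d (rev gs') i' = config d (rev gs') i" using yi that by simp
    then show ?thesis by (rule injD[OF bij_is_inj[OF bij_config]])
  qed
  have "\<exists>!i. y t i = real_of_int j" using yi uniq by (rule ex1I)
  moreover have "(THE i. y t i = real_of_int j) = i" using yi uniq by (rule the_equality)
  ultimately show "position (y t) (real_of_int j) = inv (config d (rev gs)) j"
    unfolding position_def i_def by (simp only: if_True)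
qed

text \<open>There are countably many sites, so unique existence is a countable combination of
  events.\<close>

lemma measurable_position:
  assumes "\<And>n. (\<lambda>\<omega>. y n \<omega>) \<in> borel_measurable M"
  shows "(\<lambda>\<omega>. position (\<lambda>n. y n \<omega>) v) \<in> M \<rightarrow>\<^sub>M count_space UNIV"
proof -
  let ?P = "\<lambda>m \<omega>. y m \<omega> = v"
  have P: "{\<omega> \<in> space M. ?P m \<omega>} \<in> sets M" for m
    using assms by measurable
  have ex1: "{\<omega> \<in> space M. \<exists>!m. ?P m \<omega>} \<in> sets M"
    unfolding Ex1_def
    by (intro sets.sets_Collect_countable_Ex sets.sets_Collect_conj P sets.sets_Collect_countable_All
        sets.sets_Collect_imp sets.sets_Collect_const)
  define E where "E \<omega> \<longleftrightarrow> (\<exists>!m. ?P m \<omega>)" for \<omega>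
  have E: "{\<omega> \<in> space M. E \<omega>} \<in> sets M" using ex1 by (simp only: E_def)
  have "(\<lambda>\<omega>. position (\<lambda>n. y n \<omega>) v) -` {k} \<inter> space M \<in> sets M" for k
  proof -
    \<comment> \<open>The second alternative is the default value 0.\<close>
    have pos: "position (\<lambda>n. y n \<omega>) v = k \<longleftrightarrow> E \<omega> \<and> ?P k \<omega> \<or> \<not> E \<omega> \<and> k = 0" for \<omega>
    proof (cases "E \<omega>")
      case True
      then have "\<exists>!m. ?P m \<omega>" by (simp only: E_def)
      from theI'[OF this] the1_equality[OF this] have "(THE m. ?P m \<omega>) = k \<longleftrightarrow> ?P k \<omega>" by blast
      then show ?thesis using True unfolding position_def E_def by (simp only: if_True simp_thms)
    next
      case False
      then show ?thesis unfolding position_def E_def by (simp only: if_False simp_thms eq_commute)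
    qed
    have "(\<lambda>\<omega>. position (\<lambda>n. y n \<omega>) v) -` {k} \<inter> space M =
        {\<omega> \<in> space M. E \<omega>} \<inter> {\<omega> \<in> space M. ?P k \<omega>} \<union>
        (if k = 0 then space M - {\<omega> \<in> space M. E \<omega>} else {})"
      by (rule set_eqI, unfold Int_iff vimage_singleton_eq pos) (simp; blast)
    also have "\<dots> \<in> sets M"
      using E P[of k] by (simp only: sets.Un sets.Int sets.compl_sets sets.empty_sets split: if_split) simp
    finally show ?thesis .
  qed
  then show ?thesis
    unfolding measurable_count_space_eq2_countable by (intro conjI ballI Pi_I UNIV_I)
qed

subsection \<open>Comparison of the finite-dimensional distributions\<close>

lemma (in prob_space) prob_le_prob_Int:
  assumes "A \<in> events" "B \<in> events"
  shows "prob A \<le> prob (A \<inter> B) + (1 - prob B)"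
proof -
  have "prob A \<le> prob ((A \<inter> B) \<union> (space M - B))"
    using assms sets.sets_into_space by (intro finite_measure_mono) auto
  also have "\<dots> \<le> prob (A \<inter> B) + prob (space M - B)"
    using assms by (intro measure_Un_le) auto
  finally show ?thesis using assms by (simp add: prob_compl)
qed

text \<open>On the event that a good word is followed, both probabilities are sums over good words,
  and reversing the words turns one sum into the other. The complement can be made arbitrarily
  improbable.\<close>

lemma (in asep) prob_positions_eq:
  assumes \<eta>: "\<And>n. \<eta> n = real_of_int n" and t: "0 < t"
    and J: "finite J" and A: "\<And>j. j \<in> J \<Longrightarrow> A j \<in> sets borel"
  shows "prob {\<omega> \<in> space M. \<forall>j\<in>J. real_of_int (position (\<lambda>m. Y t m \<omega>) (real_of_int j)) \<in> A j}
    = prob {\<omega> \<in> space M. \<forall>j\<in>J. Y t j \<omega> \<in> A j}"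
    (is "prob ?PX = prob ?PY")
proof -
  define m where "m = (\<Sum>j\<in>J. \<bar>j\<bar>)"
  have m: "0 \<le> m" unfolding m_def by (rule sum_nonneg) simp
  have Jm: "j \<in> {-m..m}" if "j \<in> J" for j
    using member_le_sum[OF that _ J, of abs] by (simp add: m_def abs_le_iff)
  \<comment> \<open>One set describes both events: the configuration lies in \<open>S\<close> for
    the values, its inverse lies in \<open>S\<close> for the positions.\<close>
  define S where "S = {w :: int \<Rightarrow> int. \<forall>j\<in>J. real_of_int (w j) \<in> A j}"
  let ?Z = "\<lambda>fs B. {\<omega> \<in> space M. config (\<lambda>n k. C n k \<omega>) fs \<in> B}"
  have PY: "?PY \<in> events"
  proof (rule sets.sets_Collect_finite_All[OF _ J])
    fix j assume "j \<in> J"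
    from measurable_sets[OF measurable_Y[OF less_imp_le[OF t], of j] A[OF this]]
    show "{\<omega> \<in> space M. Y t j \<omega> \<in> A j} \<in> events"
      by (simp only: vimage_def Int_def mem_Collect_eq conj_commute)
  qed
  have PX: "?PX \<in> events"
  proof (rule sets.sets_Collect_finite_All[OF _ J])
    fix j
    from measurable_sets[OF measurable_position[of "Y t" M, OF measurable_Y[OF less_imp_le[OF t]]],
        of "{i. real_of_int i \<in> A j}" "real_of_int j"]
    show "{\<omega> \<in> space M. real_of_int (position (\<lambda>m. Y t m \<omega>) (real_of_int j)) \<in> A j} \<in> events"
      by (simp only: vimage_def Int_def mem_Collect_eq conj_commute sets_count_space Pow_UNIV UNIV_I)
  qed
  have Z: "?Z fs B \<in> events" for fs B
    by (rule subsetD[OF coin_algebra_sets config_event_coin])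
  note F = follows_event_events[OF t]
  \<comment> \<open>The coins decide the configuration of a fixed word and the clocks decide which
    word is followed; these are independent.\<close>
  have ZF: "prob (?Z fs B \<inter> follows_event t L gs) = measure (law_sites p fs) B * prob (follows_event t L gs)"
    for fs B L gs
    using indep_setD[OF indep_clocks_coins follows_event_clock[OF t] config_event_coin]
    by (simp only: Int_commute mult.commute prob_config)
  have AE: "AE \<omega> in M. \<omega> \<in> space M \<longrightarrow> follows (\<lambda>n s. N n s \<omega>) t L gs \<longrightarrow> (\<forall>j\<in>{-m..m}.
      Y t j \<omega> = real_of_int (config (\<lambda>n k. C n k \<omega>) (rev gs) j) \<and>
      position (\<lambda>m. Y t m \<omega>) (real_of_int j) = inv (config (\<lambda>n k. C n k \<omega>) (rev gs)) j)"
    if "gs \<in> good_words K L m" "0 < K" for gs K L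
    using AE_clock_path dynamics initial AE_exists_good_words[OF t]
  proof eventually_elim
    case (elim \<omega>)
    show ?case
      using position_eq_inv_config[OF elim(2) _ _ t _ that] elim(1,3,4) \<eta> by simp
  qed
  \<comment> \<open>The law is that of \<open>rev gs\<close> because \<open>law_sites\<close>
    expects the newest slot first.\<close>
  have pY: "prob (?PY \<inter> follows_event t L gs) = measure (law_sites p (rev gs)) S * prob (follows_event t L gs)"
    if "gs \<in> good_words K L m" "0 < K" for gs K L
  proof -
    have "prob (?PY \<inter> follows_event t L gs) = prob (?Z (rev gs) S \<inter> follows_event t L gs)"
    proof (rule finite_measure_eq_AE)
      show "AE \<omega> in M. \<omega> \<in> ?PY \<inter> follows_event t L gs \<longleftrightarrow> \<omega> \<in> ?Z (rev gs) S \<inter> follows_event t L gs"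
        using AE[OF that]
      proof eventually_elim
        case (elim \<omega>)
        have "(\<forall>j\<in>J. Y t j \<omega> \<in> A j) \<longleftrightarrow> config (\<lambda>n k. C n k \<omega>) (rev gs) \<in> S"
          if "\<omega> \<in> follows_event t L gs"
          unfolding S_def mem_Collect_eq using elim that Jm by (intro ball_cong refl) auto
        then show ?case by blast
      qed
    qed (intro sets.Int PY Z F)+
    then show ?thesis by (simp only: ZF)
  qed
  \<comment> \<open>Inversion reverses the word a second time, so the law of \<open>gs\<close>
    itself appears.\<close>
  have pX: "prob (?PX \<inter> follows_event t L gs) = measure (law_sites p gs) S * prob (follows_event t L gs)"
    if "gs \<in> good_words K L m" "0 < K" for gs K L
  proof -
    have "prob (?PX \<inter> follows_event t L gs) = prob (?Z (rev gs) (inv -` S) \<inter> follows_event t L gs)"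
    proof (rule finite_measure_eq_AE)
      show "AE \<omega> in M. \<omega> \<in> ?PX \<inter> follows_event t L gs \<longleftrightarrow>
          \<omega> \<in> ?Z (rev gs) (inv -` S) \<inter> follows_event t L gs"
        using AE[OF that]
      proof eventually_elim
        case (elim \<omega>)
        have "(\<forall>j\<in>J. real_of_int (position (\<lambda>m. Y t m \<omega>) (real_of_int j)) \<in> A j) \<longleftrightarrow>
            config (\<lambda>n k. C n k \<omega>) (rev gs) \<in> inv -` S"
          if "\<omega> \<in> follows_event t L gs"
          unfolding S_def vimage_Collect_eq mem_Collect_eq using elim that Jm by (intro ball_cong refl) auto
        then show ?case by blast
      qed
    qed (intro sets.Int PX Z F)+
    also have "\<dots> = measure (map_pmf inv (law_sites p (rev gs))) S * prob (follows_event t L gs)"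
      by (simp only: ZF measure_map_pmf)
    finally show ?thesis by (simp only: map_inv_law_sites_rev rev_rev_ident)
  qed
  have split: "prob (P \<inter> (\<Union>gs\<in>good_words K L m. follows_event t L gs))
      = (\<Sum>gs\<in>good_words K L m. prob (P \<inter> follows_event t L gs))" if P: "P \<in> events" for P K L
  proof -
    have "disjoint_family_on (\<lambda>gs. P \<inter> follows_event t L gs) (good_words K L m)"
      using disjoint_follows[of t L K] unfolding disjoint_family_on_def good_words_def by blast
    then show ?thesis
      unfolding Int_UN_distrib
      by (intro finite_measure_finite_Union finite_good_words image_subsetI sets.Int P F)
  qed
  have eq: "prob (?PX \<inter> (\<Union>gs\<in>good_words K L m. follows_event t L gs))
      = prob (?PY \<inter> (\<Union>gs\<in>good_words K L m. follows_event t L gs))" if K: "0 < K" for K L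
  proof -
    have "prob (?PX \<inter> (\<Union>gs\<in>good_words K L m. follows_event t L gs))
        = (\<Sum>gs\<in>good_words K L m. measure (law_sites p gs) S * prob (follows_event t L gs))"
      unfolding split[OF PX] using K by (intro sum.cong refl pX)
    \<comment> \<open>Reversal permutes the good words; afterwards the clock factor is turned back
      by \<open>prob_follows_rev\<close>.\<close>
    also have "\<dots> = (\<Sum>gs\<in>good_words K L m. measure (law_sites p (rev gs)) S * prob (follows_event t L (rev gs)))"
      by (rule sum.reindex_bij_betw[symmetric])
        (rule bij_betw_byWitness[where f' = rev], auto simp: rev_in_good_words)
    also have "\<dots> = (\<Sum>gs\<in>good_words K L m. measure (law_sites p (rev gs)) S * prob (follows_event t L gs))"
    proof (intro sum.cong refl)
      fix gs assume "gs \<in> good_words K L m"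
      then have "gs \<noteq> []" using K by (auto simp: good_words_def words_def)
      from prob_follows_rev[OF t this, of L]
      show "measure (law_sites p (rev gs)) S * prob (follows_event t L (rev gs))
          = measure (law_sites p (rev gs)) S * prob (follows_event t L gs)"
        by (simp only:)
    qed
    also have "\<dots> = prob (?PY \<inter> (\<Union>gs\<in>good_words K L m. follows_event t L gs))"
      unfolding split[OF PY] using K by (intro sum.cong refl pY[symmetric])
    finally show ?thesis .
  qed
  \<comment> \<open>Stated for arbitrary \<open>P\<close> and \<open>Q\<close> so that exchanging
    them gives both inequalities.\<close>
  have le: "prob P \<le> prob Q + \<epsilon>" if \<epsilon>: "0 < \<epsilon>" and PQ: "P \<in> events" "Q \<in> events" and
    eq: "\<And>K L. 0 < K \<Longrightarrow> prob (P \<inter> (\<Union>gs\<in>good_words K L m. follows_event t L gs))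
      = prob (Q \<inter> (\<Union>gs\<in>good_words K L m. follows_event t L gs))" for \<epsilon> P Q
  proof -
    obtain K L where KL: "0 < K" "1 - \<epsilon> < prob (\<Union>gs\<in>good_words K L m. follows_event t L gs)"
      using exists_good_words_prob[OF t \<epsilon> m] .
    let ?G = "\<Union>gs\<in>good_words K L m. follows_event t L gs"
    have G: "?G \<in> events" by (intro sets.finite_UN finite_good_words F)
    have "prob P \<le> prob (P \<inter> ?G) + (1 - prob ?G)" by (rule prob_le_prob_Int[OF PQ(1) G])
    also have "\<dots> \<le> prob (Q \<inter> ?G) + \<epsilon>" using KL(2) eq[OF KL(1), of L] by linarith
    also have "prob (Q \<inter> ?G) \<le> prob Q" by (intro finite_measure_mono PQ) blast
    finally show ?thesis by simp
  qed
  show ?thesis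
  proof (rule antisym)
    show "prob ?PX \<le> prob ?PY" by (rule field_le_epsilon) (rule le[OF _ PX PY eq])
    show "prob ?PY \<le> prob ?PX" by (rule field_le_epsilon) (rule le[OF _ PY PX eq[symmetric]])
  qed
qed

section \<open>From finite-dimensional distributions to the law of the process\<close>

theorem theorem1p4:
  fixes M :: "'a measure"
    and p t :: real
    and N :: "int \<Rightarrow> real \<Rightarrow> 'a \<Rightarrow> nat"
    and C :: "int \<Rightarrow> nat \<Rightarrow> 'a \<Rightarrow> bool"
    and Y :: "real \<Rightarrow> int \<Rightarrow> 'a \<Rightarrow> real"
    and X :: "real \<Rightarrow> int \<Rightarrow> 'a \<Rightarrow> int"
  assumes "1 / 2 < p" and "p \<le> 1"
    and "asep M p (\<lambda>n. real_of_int n) N C Y"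
    and "\<And>s n \<omega>. X s n \<omega> = position (\<lambda>m. Y s m \<omega>) (real_of_int n)"
    and "0 < t"
  shows "distr M (Pi\<^sub>M UNIV (\<lambda>_. borel)) (\<lambda>\<omega> n. real_of_int (X t n \<omega>))
       = distr M (Pi\<^sub>M UNIV (\<lambda>_. borel)) (\<lambda>\<omega> n. Y t n \<omega>)"
proof -
  interpret asep M p "\<lambda>n. real_of_int n" N C Y by fact
  have Yt: "random_variable borel (Y t n)" for n
    using \<open>0 < t\<close> by (intro measurable_Y) simp
  have Xt: "random_variable borel (\<lambda>\<omega>. real_of_int (X t n \<omega>))" for n
    unfolding assms(4) by (rule measurable_compose[OF measurable_position[of "Y t" M, OF Yt]]) simp
  have Y: "(\<lambda>\<omega> n. Y t n \<omega>) \<in> M \<rightarrow>\<^sub>M Pi\<^sub>M UNIV (\<lambda>_. borel)"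
    by (rule measurable_PiM_single') (use Yt in auto)
  have X: "(\<lambda>\<omega> n. real_of_int (X t n \<omega>)) \<in> M \<rightarrow>\<^sub>M Pi\<^sub>M UNIV (\<lambda>_. borel)"
    by (rule measurable_PiM_single') (use Xt in auto)
  show ?thesis
  proof (rule measure_eqI_PiM_infinite)
    fix J :: "int set" and A :: "int \<Rightarrow> real set"
    assume J: "finite J" and A: "\<And>i. i \<in> J \<Longrightarrow> A i \<in> sets borel"
    let ?B = "prod_emb UNIV (\<lambda>_. borel) J (Pi\<^sub>E J A) :: (int \<Rightarrow> real) set"
    have B: "?B \<in> sets (Pi\<^sub>M UNIV (\<lambda>_. borel))"
      using J A by (intro sets_PiM_I) auto
    have vim: "(\<lambda>\<omega> n. Z n \<omega>) -` ?B \<inter> space M = {\<omega> \<in> space M. \<forall>j\<in>J. Z j \<omega> \<in> A j}" for Z :: "int \<Rightarrow> 'a \<Rightarrow> real"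
      by (auto simp: prod_emb_def PiE_iff space_PiM)
    have "prob {\<omega> \<in> space M. \<forall>j\<in>J. real_of_int (X t j \<omega>) \<in> A j} = prob {\<omega> \<in> space M. \<forall>j\<in>J. Y t j \<omega> \<in> A j}"
      unfolding assms(4) by (rule prob_positions_eq[OF refl \<open>0 < t\<close> J A])
    then show "emeasure (distr M (Pi\<^sub>M UNIV (\<lambda>_. borel)) (\<lambda>\<omega> n. real_of_int (X t n \<omega>))) ?B
        = emeasure (distr M (Pi\<^sub>M UNIV (\<lambda>_. borel)) (\<lambda>\<omega> n. Y t n \<omega>)) ?B"
      by (simp only: emeasure_distr[OF X B] emeasure_distr[OF Y B] vim emeasure_eq_measure)
  next
    show "finite_measure (distr M (Pi\<^sub>M UNIV (\<lambda>_. borel)) (\<lambda>\<omega> n. real_of_int (X t n \<omega>)))"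
      by (rule finite_measure_distr[OF X])
  qed simp_all
qed

end
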